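(* Let $\mathcal{C}$ be a strictly unital $A_\infty$-category, and let $\alpha\in\mathrm{Hom}_{\mathcal{C}}(L_0,L_1)$ and $\beta\in\mathrm{Hom}_{\mathcal{C}}(L_1,L_0)$ be isomorphisms, i.e. degree-zero morphisms with $$m_1(\alpha)=m_1(\beta)=0,\quad m_2(\alpha,\beta)=\mathbf{1}_{L_0}+m_1(\gamma_1),\quad m_2(\beta,\alpha)=\mathbf{1}_{L_1}+m_1(\gamma_2)$$ for some $\gamma_1\in\mathrm{Hom}_{\mathcal{C}}(L_0,L_0)$, $\gamma_2\in\mathrm{Hom}_{\mathcal{C}}(L_1,L_1)$. Then the Yoneda functors $\mathcal{Y}^0$ and $\mathcal{Y}^1$ of $L_0$ and $L_1$ are quasi-isomorphic. In particular, $L_0$ and $L_1$ are quasi-isomorphic in $\mathcal{C}$.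
   Context: $A_\infty$ conventions: operations $m_k:\mathrm{Hom}(L_0,L_1)\otimes\cdots\otimes\mathrm{Hom}(L_{k-1},L_k)\to\mathrm{Hom}(L_0,L_k)$, $k\ge1$, with $\sum(-1)^{|\mathbf{a}^{(1)}|'}m(\mathbf{a}^{(1)},m(\mathbf{a}^{(2)}),\mathbf{a}^{(3)})=0$, $|a|'=|a|-1$ (additive over strings). Units: $m_2(\mathbf 1,x)=x=(-1)^{|x|}m_2(x,\mathbf 1)$, other operations with a unit input vanish. The dg-category of chain complexes is regarded as an $A_\infty$-category $\mathcal{CH}_{A_\infty}$ by $\mathrm{Hom}_{A_\infty}(E,F)=\mathrm{Hom}_{dg}(F,E)$, $m_1=d$, $m_2(\varphi,\psi)=(-1)^{|\varphi|}\varphi\circ\psi$, $m_{k}=0$ for $k\ge3$. The Yoneda functor $\mathcal{Y}^i:\mathcal{C}\to\mathcal{CH}_{A_\infty}$ of $L_i$ is $\mathcal{Y}^i(C)=(\mathrm{Hom}_{\mathcal{C}}(C,L_i),-m_1)$ on objects, and $\mathcal{Y}^i_k(a_1,\dots,a_k)$ is the map $y\mapsto m_{k+1}(a_1,\dots,a_k,y)$. Pre-natural transformations $N:\mathcal{F}_1\to\mathcal{F}_2$ of $A_\infty$-functors $\mathcal{C}\to\mathcal{D}$ consist of multilinear maps $\mathrm{Hom}(C_0,C_1)\otimes\cdots\otimes\mathrm{Hom}(C_{k-1},C_k)\to\mathrm{Hom}(\mathcal{F}_1(C_0),\mathcal{F}_2(C_k))$ for $k\ge0$; they form a complex with the standard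 differential $M_1$ and composition $M_2$, and natural transformations are the $M_1$-closed ones. $\mathcal{F}_1,\mathcal{F}_2$ are quasi-isomorphic if there are natural transformations $N_{12}:\mathcal{F}_1\to\mathcal{F}_2$ and $N_{21}:\mathcal{F}_2\to\mathcal{F}_1$ whose compositions in both orders are cohomologous (equal up to $M_1(H)$) to the identity natural transformations. *)

theory Defs
  imports Complex_Main "HOL-Library.Function_Algebras"
begin

section \<open>Strings of homogeneous morphisms\<close>

text \<open>
  Graded modules are families of modules indexed by the integers, and every morphism is
  homogeneous.  All the homogeneous components of all the morphism spaces of a category are
  submodules of one ambient module.  They may overlap inside it, so an arrow records its source,
  its target and its degree next to its value.
\<close>

datatype ('o, 'a) arrow = Arrow (src: 'o) (tgt: 'o) (deg: int) (val: 'a)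

record ('k, 'o, 'a) ainf_cat =
  scl :: "'k \<Rightarrow> 'a \<Rightarrow> 'a"
  Obj :: "'o set"
  Hom :: "'o \<Rightarrow> 'o \<Rightarrow> int \<Rightarrow> 'a set"
  mu :: "('o, 'a) arrow list \<Rightarrow> 'a"  \<comment> \<open>\<open>m\<^sub>k\<close> on strings of length \<open>k \<ge> 1\<close>\<close>
  unt :: "'o \<Rightarrow> 'a"

text \<open>Strings are written in the order \<open>Hom(X\<^sub>0,X\<^sub>1) \<otimes> \<dots> \<otimes> Hom(X\<^sub>k\<^sub>-\<^sub>1,X\<^sub>k)\<close>.\<close>

fun is_string :: "('k, 'o, 'a, 'z) ainf_cat_scheme \<Rightarrow> 'o \<Rightarrow> ('o, 'a) arrow list \<Rightarrow> 'o \<Rightarrow> bool" where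
  "is_string C X [] Y \<longleftrightarrow> X \<in> Obj C \<and> X = Y"
| "is_string C X (a # as) Y \<longleftrightarrow>
     X \<in> Obj C \<and> src a = X \<and> val a \<in> Hom C X (tgt a) (deg a) \<and> is_string C (tgt a) as Y"

text \<open>The total shifted degree \<open>|a\<^sub>1|' + \<dots> + |a\<^sub>k|'\<close> with \<open>|a|' = |a| - 1\<close>.\<close>

definition sdeg :: "('o, 'a) arrow list \<Rightarrow> int" where
  "sdeg as = (\<Sum>a\<leftarrow>as. deg a - 1)"

definition string_end :: "'o \<Rightarrow> ('o, 'a) arrow list \<Rightarrow> 'o" where
  "string_end X as = (if as = [] then X else tgt (last as))"

text \<open>\<open>ksign n x\<close> is \<open>(-1)\<^sup>n x\<close>.\<close>

definition ksign :: "int \<Rightarrow> 'a::ab_group_add \<Rightarrow> 'a" where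
  "ksign n x = (if even n then x else - x)"

definition splits3 :: "'c list \<Rightarrow> ('c list \<times> 'c list \<times> 'c list) set" where
  "splits3 as = {(b, c, d). b @ c @ d = as}"

definition inner_splits :: "'c list \<Rightarrow> ('c list \<times> 'c list \<times> 'c list) set" where
  "inner_splits as = {(b, c, d). b @ c @ d = as \<and> c \<noteq> []}"

definition splits5 :: "'c list \<Rightarrow> ('c list \<times> 'c list \<times> 'c list \<times> 'c list \<times> 'c list) set" where
  "splits5 as = {(b, c, d, e, f). b @ c @ d @ e @ f = as}"

text \<open>
  The decompositions of a list into any number of consecutive nonempty blocks; the empty list has
  exactly one, with no blocks.
\<close>

definition blocks :: "'c list \<Rightarrow> 'c list list set" where
  "blocks as = {bs. concat bs = as \<and> [] \<notin> set bs}"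

text \<open>These sets index the sums below, so their finiteness matters.\<close>

lemma finite_sublists: "finite {b. set b \<subseteq> set as \<and> length b \<le> length as}"
  by (rule finite_lists_length_le) simp

lemma finite_splits3: "finite (splits3 as)"
proof -
  let ?S = "{b. set b \<subseteq> set as \<and> length b \<le> length as}"
  have "splits3 as \<subseteq> ?S \<times> ?S \<times> ?S"
    by (auto simp: splits3_def)
  then show ?thesis
    by (rule finite_subset) (intro finite_cartesian_product finite_sublists)
qed

lemma finite_inner_splits: "finite (inner_splits as)"
  by (rule finite_subset [OF _ finite_splits3 [of as]]) (auto simp: inner_splits_def splits3_def)

lemma finite_splits5: "finite (splits5 as)"
proof -
  let ?S = "{b. set b \<subseteq> set as \<and> length b \<le> length as}"
  have "splits5 as \<subseteq> ?S \<times> ?S \<times> ?S \<times> ?S \<times> ?S"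
    by (auto simp: splits5_def)
  then show ?thesis
    by (rule finite_subset) (intro finite_cartesian_product finite_sublists)
qed

lemma length_le_concat: "[] \<notin> set bs \<Longrightarrow> length bs \<le> length (concat bs)"
proof (induction bs)
  case (Cons b bs)
  then show ?case by (cases b) auto
qed simp

lemma length_le_concat_elem: "b \<in> set bs \<Longrightarrow> length b \<le> length (concat bs)"
  by (induction bs) auto

lemma finite_blocks: "finite (blocks as)"
proof -
  let ?S = "{b. set b \<subseteq> set as \<and> length b \<le> length as}"
  have "blocks as \<subseteq> {bs. set bs \<subseteq> ?S \<and> length bs \<le> length as}"
    by (auto simp: blocks_def length_le_concat length_le_concat_elem)
  then show ?thesis
    using finite_lists_length_le [OF finite_sublists] by (rule finite_subset)
qed

text \<open>
  Multilinearity over the ground ring of a map defined on the strings that start at \<open>X\<close>;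
  nothing is required of the empty string.
\<close>

definition multilinear_from ::
  "('k, 'o, 'a::ab_group_add, 'z) ainf_cat_scheme \<Rightarrow> ('k \<Rightarrow> 'b::ab_group_add \<Rightarrow> 'b) \<Rightarrow> 'o
     \<Rightarrow> (('o, 'a) arrow list \<Rightarrow> 'b) \<Rightarrow> bool" where
  "multilinear_from C s X f \<longleftrightarrow>
     (\<forall>as S T n x y c bs Y.
        is_string C X (as @ Arrow S T n x # bs) Y \<and> is_string C X (as @ Arrow S T n y # bs) Y \<longrightarrow>
          f (as @ Arrow S T n (x + y) # bs)
            = f (as @ Arrow S T n x # bs) + f (as @ Arrow S T n y # bs) \<and>
          f (as @ Arrow S T n (scl C c x) # bs) = s c (f (as @ Arrow S T n x # bs)))"


section \<open>\<open>A\<^sub>\<infinity>\<close>-categories\<close>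

text \<open>
  The value of \<open>m\<^sub>k\<close> on a nonempty string, as an arrow: \<open>m\<^sub>k\<close> has degree \<open>2 - k\<close>, that is, it
  raises the shifted degree by one.
\<close>

definition mu_arrow ::
  "('k, 'o, 'a, 'z) ainf_cat_scheme \<Rightarrow> ('o, 'a) arrow list \<Rightarrow> ('o, 'a) arrow" where
  "mu_arrow C as = Arrow (src (hd as)) (tgt (last as)) (sdeg as + 2) (mu C as)"

definition ainf_category ::
  "('k::comm_ring_1, 'o, 'a::ab_group_add, 'z) ainf_cat_scheme \<Rightarrow> bool" where
  "ainf_category C \<longleftrightarrow>
     module (scl C) \<and>
     (\<forall>X\<in>Obj C. \<forall>Y\<in>Obj C. \<forall>n. module.subspace (scl C) (Hom C X Y n)) \<and>
     (\<forall>X as Y. is_string C X as Y \<and> as \<noteq> [] \<longrightarrow> mu C as \<in> Hom C X Y (sdeg as + 2)) \<and>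
     (\<forall>X\<in>Obj C. multilinear_from C (scl C) X (mu C)) \<and>
     (\<forall>X as Y. is_string C X as Y \<and> as \<noteq> [] \<longrightarrow>
        (\<Sum>(b, c, d)\<in>inner_splits as. ksign (sdeg b) (mu C (b @ mu_arrow C c # d))) = 0)"

definition unit_arrow :: "('k, 'o, 'a, 'z) ainf_cat_scheme \<Rightarrow> 'o \<Rightarrow> ('o, 'a) arrow" where
  "unit_arrow C X = Arrow X X 0 (unt C X)"

definition strictly_unital ::
  "('k::comm_ring_1, 'o, 'a::ab_group_add, 'z) ainf_cat_scheme \<Rightarrow> bool" where
  "strictly_unital C \<longleftrightarrow>
     (\<forall>X\<in>Obj C. unt C X \<in> Hom C X X 0) \<and>
     (\<forall>X Y a. is_string C X [a] Y \<longrightarrow>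
        mu C [unit_arrow C X, a] = val a \<and>
        ksign (deg a) (mu C [a, unit_arrow C Y]) = val a) \<and>
     (\<forall>X b Z d Y. is_string C X (b @ unit_arrow C Z # d) Y \<and> length (b @ unit_arrow C Z # d) \<noteq> 2
        \<longrightarrow> mu C (b @ unit_arrow C Z # d) = 0)"

text \<open>
  Two objects are quasi-isomorphic if they are isomorphic in the cohomology category
  \<open>H\<^sup>0(C)\<close>.
\<close>

definition cohomologous ::
  "('k, 'o, 'a::ab_group_add, 'z) ainf_cat_scheme \<Rightarrow> 'o \<Rightarrow> 'o \<Rightarrow> int \<Rightarrow> 'a \<Rightarrow> 'a \<Rightarrow> bool" where
  "cohomologous C X Y n x y \<longleftrightarrow> (\<exists>z\<in>Hom C X Y (n - 1). x = y + mu C [Arrow X Y (n - 1) z])"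

definition quasi_isomorphic_objects ::
  "('k, 'o, 'a::ab_group_add, 'z) ainf_cat_scheme \<Rightarrow> 'o \<Rightarrow> 'o \<Rightarrow> bool" where
  "quasi_isomorphic_objects C X Y \<longleftrightarrow>
     X \<in> Obj C \<and> Y \<in> Obj C \<and>
     (\<exists>f\<in>Hom C X Y 0. \<exists>g\<in>Hom C Y X 0.
        mu C [Arrow X Y 0 f] = 0 \<and> mu C [Arrow Y X 0 g] = 0 \<and>
        cohomologous C X X 0 (mu C [Arrow X Y 0 f, Arrow Y X 0 g]) (unt C X) \<and>
        cohomologous C Y Y 0 (mu C [Arrow Y X 0 g, Arrow X Y 0 f]) (unt C Y))"


section \<open>\<open>A\<^sub>\<infinity>\<close>-functors\<close>

record ('o, 'a, 'p, 'b) ainf_fun =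
  fobj :: "'o \<Rightarrow> 'p"
  fmor :: "('o, 'a) arrow list \<Rightarrow> 'b"  \<comment> \<open>\<open>F\<^sub>k\<close> on strings of length \<open>k \<ge> 1\<close>\<close>

text \<open>\<open>F\<^sub>k\<close> has degree \<open>1 - k\<close>, that is, it preserves the shifted degree.\<close>

definition fun_arrow ::
  "('o, 'a, 'p, 'b) ainf_fun \<Rightarrow> ('o, 'a) arrow list \<Rightarrow> ('p, 'b) arrow" where
  "fun_arrow F as =
     Arrow (fobj F (src (hd as))) (fobj F (tgt (last as))) (sdeg as + 1) (fmor F as)"

definition ainf_functor ::
  "('k::comm_ring_1, 'o, 'a::ab_group_add, 'z) ainf_cat_scheme
     \<Rightarrow> ('k, 'p, 'b::ab_group_add, 'w) ainf_cat_scheme \<Rightarrow> ('o, 'a, 'p, 'b) ainf_fun \<Rightarrow> bool" where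
  "ainf_functor C D F \<longleftrightarrow>
     (\<forall>X\<in>Obj C. fobj F X \<in> Obj D) \<and>
     (\<forall>X as Y. is_string C X as Y \<and> as \<noteq> [] \<longrightarrow>
        fmor F as \<in> Hom D (fobj F X) (fobj F Y) (sdeg as + 1)) \<and>
     (\<forall>X\<in>Obj C. multilinear_from C (scl D) X (fmor F)) \<and>
     (\<forall>X as Y. is_string C X as Y \<and> as \<noteq> [] \<longrightarrow>
        (\<Sum>bs\<in>blocks as. mu D (map (fun_arrow F) bs))
          = (\<Sum>(b, c, d)\<in>inner_splits as. ksign (sdeg b) (fmor F (b @ mu_arrow C c # d))))"


section \<open>Pre-natural transformations\<close>

text \<open>
  A pre-natural transformation \<open>N\<close> takes the initial object of a string and the string itself; the
  object matters for the empty string, on which \<open>N\<close> is the component \<open>N\<^sub>0\<close>.  Degree \<open>n\<close> means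
  that \<open>N\<^sub>k\<close> has degree \<open>n - k\<close>.
\<close>

type_synonym ('o, 'a, 'b) pretrans = "'o \<Rightarrow> ('o, 'a) arrow list \<Rightarrow> 'b"

definition pre_natural ::
  "('k::comm_ring_1, 'o, 'a::ab_group_add, 'z) ainf_cat_scheme
     \<Rightarrow> ('k, 'p, 'b::ab_group_add, 'w) ainf_cat_scheme
     \<Rightarrow> int \<Rightarrow> ('o, 'a, 'p, 'b) ainf_fun \<Rightarrow> ('o, 'a, 'p, 'b) ainf_fun
     \<Rightarrow> ('o, 'a, 'b) pretrans \<Rightarrow> bool" where
  "pre_natural C D n F G N \<longleftrightarrow>
     (\<forall>X as Y. is_string C X as Y \<longrightarrow> N X as \<in> Hom D (fobj F X) (fobj G Y) (sdeg as + n)) \<and>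
     (\<forall>X\<in>Obj C. multilinear_from C (scl D) X (N X))"

definition trans_arrow ::
  "int \<Rightarrow> ('o, 'a, 'p, 'b) ainf_fun \<Rightarrow> ('o, 'a, 'p, 'b) ainf_fun
     \<Rightarrow> ('o, 'a, 'b) pretrans \<Rightarrow> 'o \<Rightarrow> ('o, 'a) arrow list \<Rightarrow> ('p, 'b) arrow" where
  "trans_arrow n F G N X as =
     Arrow (fobj F X) (fobj G (string_end X as)) (sdeg as + n) (N X as)"

text \<open>
  The differential and the composition, for \<open>N : F \<rightarrow> G\<close> of degree \<open>n\<close>,
  \<open>N\<^sub>1 : F \<rightarrow> G\<close> of degree \<open>n\<^sub>1\<close> and \<open>N\<^sub>2 : G \<rightarrow> H\<close> of degree \<open>n\<^sub>2\<close>.  Every sign is the Koszul sign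
  for shifted degrees: a transformation of degree \<open>n\<close> has shifted degree \<open>n - 1\<close> and moves past
  the inputs to its left.
\<close>

definition trans_M1 ::
  "('k::comm_ring_1, 'o, 'a::ab_group_add, 'z) ainf_cat_scheme
     \<Rightarrow> ('k, 'p, 'b::ab_group_add, 'w) ainf_cat_scheme
     \<Rightarrow> int \<Rightarrow> ('o, 'a, 'p, 'b) ainf_fun \<Rightarrow> ('o, 'a, 'p, 'b) ainf_fun
     \<Rightarrow> ('o, 'a, 'b) pretrans \<Rightarrow> ('o, 'a, 'b) pretrans" where
  "trans_M1 C D n F G N X as =
     (\<Sum>(b, c, d)\<in>splits3 as. \<Sum>bs\<in>blocks b. \<Sum>ds\<in>blocks d.
        ksign ((n - 1) * sdeg b)
          (mu D (map (fun_arrow F) bs @ trans_arrow n F G N (string_end X b) c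
                 # map (fun_arrow G) ds)))
     - ksign (n - 1)
         (\<Sum>(b, c, d)\<in>inner_splits as. ksign (sdeg b) (N X (b @ mu_arrow C c # d)))"

definition trans_M2 ::
  "('k::comm_ring_1, 'p, 'b::ab_group_add, 'w) ainf_cat_scheme
     \<Rightarrow> int \<Rightarrow> int \<Rightarrow> ('o, 'a, 'p, 'b) ainf_fun \<Rightarrow> ('o, 'a, 'p, 'b) ainf_fun
     \<Rightarrow> ('o, 'a, 'p, 'b) ainf_fun
     \<Rightarrow> ('o, 'a, 'b) pretrans \<Rightarrow> ('o, 'a, 'b) pretrans \<Rightarrow> ('o, 'a, 'b) pretrans" where
  "trans_M2 D n1 n2 F G H N1 N2 X as =
     (\<Sum>(b, c, d, e, f)\<in>splits5 as. \<Sum>bs\<in>blocks b. \<Sum>ds\<in>blocks d. \<Sum>fs\<in>blocks f.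
        ksign ((n1 - 1) * sdeg b + (n2 - 1) * (sdeg b + sdeg c + sdeg d))
          (mu D (map (fun_arrow F) bs
                 @ trans_arrow n1 F G N1 (string_end X b) c # map (fun_arrow G) ds
                 @ trans_arrow n2 G H N2 (string_end X (b @ c @ d)) e # map (fun_arrow H) fs)))"

definition trans_id ::
  "('k, 'p, 'b::ab_group_add, 'w) ainf_cat_scheme \<Rightarrow> ('o, 'a, 'p, 'b) ainf_fun
     \<Rightarrow> ('o, 'a, 'b) pretrans" where
  "trans_id D F X as = (if as = [] then unt D (fobj F X) else 0)"

definition natural_trans ::
  "('k::comm_ring_1, 'o, 'a::ab_group_add, 'z) ainf_cat_scheme
     \<Rightarrow> ('k, 'p, 'b::ab_group_add, 'w) ainf_cat_scheme
     \<Rightarrow> int \<Rightarrow> ('o, 'a, 'p, 'b) ainf_fun \<Rightarrow> ('o, 'a, 'p, 'b) ainf_fun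
     \<Rightarrow> ('o, 'a, 'b) pretrans \<Rightarrow> bool" where
  "natural_trans C D n F G N \<longleftrightarrow>
     pre_natural C D n F G N \<and>
     (\<forall>X as Y. is_string C X as Y \<longrightarrow> trans_M1 C D n F G N X as = 0)"

definition cohomologous_trans ::
  "('k::comm_ring_1, 'o, 'a::ab_group_add, 'z) ainf_cat_scheme
     \<Rightarrow> ('k, 'p, 'b::ab_group_add, 'w) ainf_cat_scheme
     \<Rightarrow> int \<Rightarrow> ('o, 'a, 'p, 'b) ainf_fun \<Rightarrow> ('o, 'a, 'p, 'b) ainf_fun
     \<Rightarrow> ('o, 'a, 'b) pretrans \<Rightarrow> ('o, 'a, 'b) pretrans \<Rightarrow> bool" where
  "cohomologous_trans C D n F G N N' \<longleftrightarrow>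
     (\<exists>H. pre_natural C D (n - 1) F G H \<and>
        (\<forall>X as Y. is_string C X as Y \<longrightarrow> N X as = N' X as + trans_M1 C D (n - 1) F G H X as))"

definition quasi_isomorphic_functors ::
  "('k::comm_ring_1, 'o, 'a::ab_group_add, 'z) ainf_cat_scheme
     \<Rightarrow> ('k, 'p, 'b::ab_group_add, 'w) ainf_cat_scheme
     \<Rightarrow> ('o, 'a, 'p, 'b) ainf_fun \<Rightarrow> ('o, 'a, 'p, 'b) ainf_fun \<Rightarrow> bool" where
  "quasi_isomorphic_functors C D F G \<longleftrightarrow>
     ainf_functor C D F \<and> ainf_functor C D G \<and>
     (\<exists>N12 N21. natural_trans C D 0 F G N12 \<and> natural_trans C D 0 G F N21 \<and>
        cohomologous_trans C D 0 F F (trans_M2 D 0 0 F G F N12 N21) (trans_id D F) \<and>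
        cohomologous_trans C D 0 G G (trans_M2 D 0 0 G F G N21 N12) (trans_id D G))"


section \<open>Chain complexes as an \<open>A\<^sub>\<infinity>\<close>-category\<close>

text \<open>
  Differentials have degree \<open>1\<close>.  Linear maps between submodules of the ambient module are
  represented by functions that vanish off their domain, so that equality of functions is equality
  of maps.
\<close>

definition linear_between ::
  "('k::comm_ring_1 \<Rightarrow> 'a::ab_group_add \<Rightarrow> 'a) \<Rightarrow> 'a set \<Rightarrow> 'a set \<Rightarrow> ('a \<Rightarrow> 'a) \<Rightarrow> bool" where
  "linear_between s V W f \<longleftrightarrow>
     (\<forall>x\<in>V. f x \<in> W) \<and> (\<forall>x\<in>V. \<forall>y\<in>V. f (x + y) = f x + f y) \<and>
     (\<forall>c. \<forall>x\<in>V. f (s c x) = s c (f x)) \<and> (\<forall>x. x \<notin> V \<longrightarrow> f x = 0)"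

record 'a complex =
  cgr :: "int \<Rightarrow> 'a set"
  cdiff :: "int \<Rightarrow> 'a \<Rightarrow> 'a"

definition is_complex ::
  "('k::comm_ring_1 \<Rightarrow> 'a::ab_group_add \<Rightarrow> 'a) \<Rightarrow> 'a complex \<Rightarrow> bool" where
  "is_complex s E \<longleftrightarrow>
     (\<forall>n. module.subspace s (cgr E n)) \<and>
     (\<forall>n. linear_between s (cgr E n) (cgr E (n + 1)) (cdiff E n)) \<and>
     (\<forall>n. \<forall>x\<in>cgr E n. cdiff E (n + 1) (cdiff E n x) = 0)"

text \<open>The dg-category: morphisms \<open>E \<rightarrow> F\<close> of degree \<open>n\<close>, their differential, and composition.\<close>

definition dg_hom ::
  "('k::comm_ring_1 \<Rightarrow> 'a::ab_group_add \<Rightarrow> 'a) \<Rightarrow> 'a complex \<Rightarrow> 'a complex \<Rightarrow> int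
     \<Rightarrow> (int \<Rightarrow> 'a \<Rightarrow> 'a) set" where
  "dg_hom s E F n = {\<phi>. \<forall>i. linear_between s (cgr E i) (cgr F (i + n)) (\<phi> i)}"

definition dg_diff ::
  "'a::ab_group_add complex \<Rightarrow> 'a complex \<Rightarrow> int \<Rightarrow> (int \<Rightarrow> 'a \<Rightarrow> 'a) \<Rightarrow> int \<Rightarrow> 'a \<Rightarrow> 'a" where
  "dg_diff E F n \<phi> = (\<lambda>i x. cdiff F (i + n) (\<phi> i x) - ksign n (\<phi> (i + 1) (cdiff E i x)))"

definition dg_comp ::
  "(int \<Rightarrow> 'a \<Rightarrow> 'a) \<Rightarrow> int \<Rightarrow> (int \<Rightarrow> 'a \<Rightarrow> 'a) \<Rightarrow> int \<Rightarrow> 'a \<Rightarrow> 'a" where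
  "dg_comp \<phi> n \<psi> = (\<lambda>i x. \<phi> (i + n) (\<psi> i x))"  \<comment> \<open>\<open>n\<close> is the degree of \<open>\<psi>\<close>\<close>

definition dg_id :: "'a::ab_group_add complex \<Rightarrow> int \<Rightarrow> 'a \<Rightarrow> 'a" where
  "dg_id E = (\<lambda>i x. if x \<in> cgr E i then x else 0)"

text \<open>
  An arrow of this \<open>A\<^sub>\<infinity>\<close>-category from \<open>E\<close> to \<open>F\<close> is a map of complexes from \<open>F\<close> to \<open>E\<close>.
\<close>

fun CH_mu :: "('a::ab_group_add complex, int \<Rightarrow> 'a \<Rightarrow> 'a) arrow list \<Rightarrow> int \<Rightarrow> 'a \<Rightarrow> 'a" where
  "CH_mu [a] = dg_diff (tgt a) (src a) (deg a) (val a)"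
| "CH_mu [a, b] = ksign (deg a) (dg_comp (val a) (deg b) (val b))"
| "CH_mu _ = 0"

definition CH ::
  "('k::comm_ring_1 \<Rightarrow> 'a::ab_group_add \<Rightarrow> 'a)
     \<Rightarrow> ('k, 'a complex, int \<Rightarrow> 'a \<Rightarrow> 'a) ainf_cat" where
  "CH s =
     \<lparr> scl = (\<lambda>c \<phi> i x. s c (\<phi> i x)),
       Obj = {E. is_complex s E},
       Hom = (\<lambda>E F n. dg_hom s F E n),
       mu = CH_mu,
       unt = dg_id \<rparr>"


section \<open>Yoneda functors\<close>

definition yoneda_complex ::
  "('k, 'o, 'a::ab_group_add, 'z) ainf_cat_scheme \<Rightarrow> 'o \<Rightarrow> 'o \<Rightarrow> 'a complex" where
  "yoneda_complex C L X =
     \<lparr> cgr = Hom C X L,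
       cdiff = (\<lambda>n y. if y \<in> Hom C X L n then - mu C [Arrow X L n y] else 0) \<rparr>"

definition yoneda ::
  "('k, 'o, 'a::ab_group_add, 'z) ainf_cat_scheme \<Rightarrow> 'o
     \<Rightarrow> ('o, 'a, 'a complex, int \<Rightarrow> 'a \<Rightarrow> 'a) ainf_fun" where
  "yoneda C L =
     \<lparr> fobj = yoneda_complex C L,
       fmor = (\<lambda>as n y. if y \<in> Hom C (tgt (last as)) L n
                        then mu C (as @ [Arrow (tgt (last as)) L n y]) else 0) \<rparr>"

end

theory Submission
  imports Defs
begin

text \<open>
  For a string \<open>t\<close> from \<open>L'\<close> to \<open>L\<close>, appending \<open>t\<close> to the inputs defines, with a Koszul sign, a
  pre-natural transformation \<open>N\<^sub>t\<close> between the Yoneda functors of \<open>L\<close> and \<open>L'\<close>: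
  \<open>(a\<^sub>1,\<dots>,a\<^sub>k)\<close> goes to \<open>y \<mapsto> \<plusminus> m(a\<^sub>1,\<dots>,a\<^sub>k,y,t)\<close>.  The terms of \<open>M\<^sub>1(N\<^sub>t)\<close> are the terms of the
  \<open>A\<^sub>\<infinity>\<close>-relation for \<open>(a\<^sub>1,\<dots>,a\<^sub>k,y,t)\<close> in which the inner operation swallows all of \<open>t\<close> with \<open>y\<close>, or
  nothing of \<open>t\<close>; so \<open>M\<^sub>1(N\<^sub>t)\<close> equals the remaining terms.  Consequently \<open>M\<^sub>1(N\<^sub>x) = N\<^sub>m\<close> with
  \<open>m = m\<^sub>1(x)\<close> for a single morphism \<open>x\<close>, so \<open>N\<^sub>\<beta>\<close> and \<open>N\<^sub>\<alpha>\<close> are closed; for \<open>t = (\<alpha>, \<beta>)\<close> the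
  remaining terms are \<open>M\<^sub>2(N\<^sub>\<beta>, N\<^sub>\<alpha>)\<close> and \<open>N\<^sub>m\<close> with \<open>m = m\<^sub>2(\<alpha>, \<beta>) = 1 + m\<^sub>1(\<gamma>\<^sub>1)\<close>.  Since the
  transformation of a unit is minus the identity, \<open>N\<^sub>t - N\<^sub>\<gamma>\<close> with \<open>\<gamma> = \<gamma>\<^sub>1\<close> is a homotopy from
  \<open>M\<^sub>2(N\<^sub>\<beta>, N\<^sub>\<alpha>)\<close> to the identity.
\<close>

section \<open>Signs\<close>

lemma ksign_0 [simp]: "ksign n 0 = 0"
  and ksign_zero [simp]: "ksign 0 x = x"
  and ksign_ksign [simp]: "ksign m (ksign n x) = ksign (m + n) x"
  and ksign_add: "ksign n (x + y) = ksign n x + ksign n y"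
  and ksign_diff: "ksign n (x - y) = ksign n x - ksign n y"
  and ksign_minus: "ksign n (- x) = - ksign n x"
  by (auto simp: ksign_def)

lemma ksign_plus_one: "ksign (n + 1) x = - ksign n x"
  by (simp add: ksign_def)

lemma ksign_sum: "ksign n (sum f A) = (\<Sum>a\<in>A. ksign n (f a))"
  by (auto simp: ksign_def sum_negf)

lemma ksign_parity: "even m = even n \<Longrightarrow> ksign m x = ksign n x"
  by (simp add: ksign_def)

lemma ksign_even: "even n \<Longrightarrow> ksign n x = x"
  by (simp add: ksign_def)

lemma ksign_apply: "ksign n f x = ksign n (f x)"
  by (simp add: ksign_def)

lemma sum_apply: "sum f A x = (\<Sum>a\<in>A. f a x)"
  by (induction A rule: infinite_finite_induct) auto

lemma sdeg_Nil [simp]: "sdeg [] = 0"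
  and sdeg_Cons [simp]: "sdeg (a # as) = deg a - 1 + sdeg as"
  and sdeg_append [simp]: "sdeg (as @ bs) = sdeg as + sdeg bs"
  by (simp_all add: sdeg_def)

section \<open>Decompositions of lists\<close>

definition splits2 :: "'c list \<Rightarrow> ('c list \<times> 'c list) set" where
  "splits2 as = {(b, c). b @ c = as}"

lemma splits2_simps [simp]:
  "splits2 [] = {([], [])}"
  "splits2 (a # as) = insert ([], a # as) ((\<lambda>(b, c). (a # b, c)) ` splits2 as)"
  by (auto simp: splits2_def Cons_eq_append_conv append_eq_Cons_conv)

lemma finite_splits2 [simp]: "finite (splits2 as)"
  by (induction as) simp_all

text \<open>The first letter either opens the inner block or belongs to the left piece. Applied
  repeatedly, this lists all the terms for a tail of one or two letters.\<close>

lemma inner_splits_simps [simp]: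
  "inner_splits [] = {}"
  "inner_splits (a # as) =
     (\<lambda>(c, d). ([], a # c, d)) ` splits2 as \<union> (\<lambda>(b, c, d). (a # b, c, d)) ` inner_splits as"
  by (auto simp: inner_splits_def splits2_def Cons_eq_append_conv append_eq_Cons_conv image_iff)

text \<open>The inner block lies before the marked letter \<open>y\<close>, contains it, or lies
  after it. In the A-infinity relation, \<open>y\<close> will be the argument of a transformation
  and \<open>t\<close> the appended tail.\<close>

lemma sum_inner_splits_append:
  fixes f :: "_ \<Rightarrow> 'b::ab_group_add"
  shows "sum f (inner_splits (as @ y # t)) =
     (\<Sum>(b, c, d)\<in>inner_splits as. f (b, c, d @ y # t))
   + (\<Sum>(b, c)\<in>splits2 as. \<Sum>(u, v)\<in>splits2 t. f (b, c @ y # u, v))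
   + (\<Sum>(u, c, d)\<in>inner_splits t. f (as @ y # u, c, d))"
proof -
  define A where "A = (\<lambda>(b, c, d). (b, c, d @ y # t)) ` inner_splits as"
  define B where "B = (\<lambda>((b, c), (u, v)). (b, c @ y # u, v)) ` (splits2 as \<times> splits2 t)"
  define C where "C = (\<lambda>(u, c, d). (as @ y # u, c, d)) ` inner_splits t"
  have eq: "inner_splits (as @ y # t) = A \<union> B \<union> C"
  proof (intro equalityI subsetI)
    fix p assume "p \<in> inner_splits (as @ y # t)"
    then obtain b c d where p: "p = (b, c, d)" "b @ c @ d = as @ y # t" "c \<noteq> []"
      by (auto simp: inner_splits_def)
    \<comment> \<open>Compare first the end of \<open>b\<close> with the position of
      \<open>y\<close>, and then, if \<open>b\<close> stays inside \<open>as\<close>, the end of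
      \<open>c\<close>.\<close>
    consider c' where "as = b @ c'" "c @ d = c' @ y # t"
      | u where "b = as @ y # u" "u @ c @ d = t"
      using p(2,3) by (auto simp: append_eq_append_conv2 append_eq_Cons_conv Cons_eq_append_conv)
    then show "p \<in> A \<union> B \<union> C"
    proof cases
      case 1
      then consider d' where "c' = c @ d'" "d = d' @ y # t"
        | u where "c = c' @ y # u" "u @ d = t"
        by (auto simp: append_eq_append_conv2 append_eq_Cons_conv Cons_eq_append_conv)
      then show ?thesis
      proof cases
        case 1
        then have "p \<in> A"
          using p \<open>as = b @ c'\<close> by (force simp: A_def inner_splits_def)
        then show ?thesis by blast
      next
        case 2
        then have "p = (\<lambda>((b, c), (u, v)). (b, c @ y # u, v)) ((b, c'), (u, d))"
          using p by simp
        moreover have "((b, c'), (u, d)) \<in> splits2 as \<times> splits2 t"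
          using 2 \<open>as = b @ c'\<close> by (simp add: splits2_def)
        ultimately show ?thesis unfolding B_def by blast
      qed
    next
      case 2
      then have "p \<in> C"
        using p by (force simp: C_def inner_splits_def)
      then show ?thesis by blast
    qed
  qed (auto simp: A_def B_def C_def inner_splits_def splits2_def)
  \<comment> \<open>The lengths of the two outer pieces tell the three families apart, also when
    letters of the list repeat.\<close>
  have disj: "A \<inter> B = {}" "(A \<union> B) \<inter> C = {}"
  proof -
    have A: "length d > length t \<and> length b \<le> length as" if "(b, c, d) \<in> A" for b c d
      using that by (auto simp: A_def inner_splits_def)
    have B: "length d \<le> length t \<and> length b \<le> length as" if "(b, c, d) \<in> B" for b c d
      using that by (auto simp: B_def splits2_def)
    have C: "length b > length as" if "(b, c, d) \<in> C" for b c d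
      using that by (auto simp: C_def)
    show "A \<inter> B = {}"
      by (auto simp: disjoint_iff dest!: A B)
    show "(A \<union> B) \<inter> C = {}"
      by (auto simp: disjoint_iff dest!: A B C)
  qed
  have fin: "finite A" "finite B" "finite C"
    by (simp_all add: A_def B_def C_def finite_inner_splits)
  have inj: "inj_on (\<lambda>(b, c, d). (b, c, d @ y # t)) (inner_splits as)"
    "inj_on (\<lambda>((b, c), (u, v)). (b, c @ y # u, v)) (splits2 as \<times> splits2 t)"
    "inj_on (\<lambda>(u, c, d). (as @ y # u, c, d)) (inner_splits t)"
    by (auto simp: inj_on_def splits2_def)
  have "sum f (inner_splits (as @ y # t)) = sum f A + sum f B + sum f C"
    unfolding eq using disj fin by (simp add: sum.union_disjoint)
  also have "sum f B = (\<Sum>(b, c)\<in>splits2 as. \<Sum>(u, v)\<in>splits2 t. f (b, c @ y # u, v))"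
    unfolding B_def by (subst sum.reindex [OF inj(2)])
       (auto simp: sum.cartesian_product' case_prod_beta intro!: sum.cong)
  also have "sum f A = (\<Sum>(b, c, d)\<in>inner_splits as. f (b, c, d @ y # t))"
    unfolding A_def by (subst sum.reindex [OF inj(1)]) (simp add: case_prod_beta)
  also have "sum f C = (\<Sum>(u, c, d)\<in>inner_splits t. f (as @ y # u, c, d))"
    unfolding C_def by (subst sum.reindex [OF inj(3)]) (simp add: case_prod_beta)
  finally show ?thesis .
qed

lemma blocks_Nil [simp]: "blocks [] = {[]}"
  by (auto simp: blocks_def) (metis list.set_intros(1) neq_Nil_conv)

lemma list_length_two_cases:
  obtains "xs = []" | x where "xs = [x]" | x y where "xs = [x, y]" | "length xs \<ge> 3"
  \<comment> \<open>\<open>remdups_adj.cases\<close> serves for its shape: empty, one letter, at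
    least two letters.\<close>
  by (cases xs rule: remdups_adj.cases) (auto simp: Suc_le_eq numeral_3_eq_3)

text \<open>Meant for \<open>CH_mu\<close>, which vanishes on three or more inputs. Blocks are
  nonempty, so the two splittings with an empty piece do not give pairs of blocks.\<close>

lemma sum_blocks_two:
  fixes h :: "_ \<Rightarrow> 'b::ab_group_add"
  assumes "\<And>bs. length bs \<ge> 3 \<Longrightarrow> h bs = 0" and "as \<noteq> []"
  shows "sum h (blocks as) = h [as] + (\<Sum>(b, c)\<in>splits2 as - {([], as), (as, [])}. h [b, c])"
proof -
  let ?S = "splits2 as - {([], as), (as, [])}"
  let ?T = "(\<lambda>(b, c). [b, c]) ` ?S"
  have sub: "insert [as] ?T \<subseteq> blocks as"
    using \<open>as \<noteq> []\<close> by (auto simp: blocks_def splits2_def)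
  have "h bs = 0" if "bs \<in> blocks as - insert [as] ?T" for bs
  proof (cases bs rule: list_length_two_cases)
    case (3 x y)
    then have "(x, y) \<in> ?S"
      using that by (auto simp: blocks_def splits2_def)
    then show ?thesis
      using that 3 by force
  qed (use that assms in \<open>auto simp: blocks_def\<close>)
  then have "sum h (blocks as) = sum h (insert [as] ?T)"
    by (intro sum.mono_neutral_right finite_blocks sub) blast
  also have "\<dots> = h [as] + sum h ?T"
    by (subst sum.insert) auto
  also have "sum h ?T = (\<Sum>(b, c)\<in>?S. h [b, c])"
    by (subst sum.reindex) (auto simp: inj_on_def case_prod_beta)
  finally show ?thesis .
qed

lemma sum_blocks_one:
  fixes h :: "_ \<Rightarrow> 'b::ab_group_add"
  assumes "\<And>bs. length bs \<ge> 2 \<Longrightarrow> h bs = 0"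
  shows "sum h (blocks as) = (if as = [] then h [] else h [as])"
  using sum_blocks_two [of h as] assms by (auto intro!: sum.neutral)

text \<open>A term of \<open>trans_M1\<close> with functor blocks on both sides of the
  transformation has at least three inputs, so it vanishes in \<open>CH\<close>. The splitting with
  both sides empty belongs to both one-sided families and is therefore counted separately.\<close>

lemma sum_splits3_one_sided:
  fixes f :: "_ \<Rightarrow> 'b::ab_group_add"
  assumes "\<And>b c d. b \<noteq> [] \<Longrightarrow> d \<noteq> [] \<Longrightarrow> f (b, c, d) = 0"
  shows "sum f (splits3 as) = f ([], as, [])
    + (\<Sum>(b, c)\<in>splits2 as - {([], as)}. f (b, c, []))
    + (\<Sum>(c, d)\<in>splits2 as - {(as, [])}. f ([], c, d))"
proof -
  let ?S = "splits2 as - {([], as)}" and ?T = "splits2 as - {(as, [])}"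
  let ?A = "(\<lambda>(b, c). (b, c, [])) ` ?S" and ?B = "(\<lambda>(c, d). ([], c, d)) ` ?T"
  have "sum f (splits3 as) = sum f (insert ([], as, []) (?A \<union> ?B))"
  proof (rule sum.mono_neutral_right)
    show "\<forall>p\<in>splits3 as - insert ([], as, []) (?A \<union> ?B). f p = 0"
    proof
      fix p assume p: "p \<in> splits3 as - insert ([], as, []) (?A \<union> ?B)"
      obtain b c d where bcd: "p = (b, c, d)" by (cases p)
      have "b \<noteq> [] \<and> d \<noteq> []"
        using p unfolding bcd
        by (cases "b = []"; cases "d = []") (force simp: splits3_def splits2_def)+
      then show "f p = 0"
        using assms bcd by simp
    qed
  qed (simp add: finite_splits3, auto simp: splits3_def splits2_def)
  also have "\<dots> = f ([], as, []) + (sum f ?A + sum f ?B)"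
    by (subst sum.insert, simp, force simp: splits2_def, subst sum.union_disjoint)
       (simp_all, auto simp: splits2_def)
  also have "sum f ?A = (\<Sum>(b, c)\<in>?S. f (b, c, []))"
    by (subst sum.reindex) (auto simp: inj_on_def case_prod_beta)
  also have "sum f ?B = (\<Sum>(c, d)\<in>?T. f ([], c, d))"
    by (subst sum.reindex) (auto simp: inj_on_def case_prod_beta)
  finally show ?thesis
    by (simp add: add.assoc)
qed

lemma string_end_simps [simp]:
  "string_end X [] = X"
  "string_end X (a # as) = string_end (tgt a) as"
  "string_end X (as @ bs) = string_end (string_end X as) bs"
  by (auto simp: string_end_def)

section \<open>Pre-natural transformations between functors to chain complexes\<close>

lemma CH_simps [simp]:
  "scl (CH s) = (\<lambda>c \<phi> i x. s c (\<phi> i x))"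
  "Obj (CH s) = {E. is_complex s E}"
  "Hom (CH s) E F n = dg_hom s F E n"
  "mu (CH s) = CH_mu"
  "unt (CH s) = dg_id"
  by (simp_all add: CH_def)

lemma CH_mu_long: "length as \<ge> 3 \<Longrightarrow> CH_mu as = 0"
  by (cases as rule: CH_mu.cases) auto

text \<open>With m_1 and m_2 as the sole nonzero operations, at most one functor block stands next
  to \<open>T\<close>. The exponent \<open>n * sdeg b + 1\<close> is the Koszul exponent
  \<open>(n - 1) * sdeg b\<close> plus the degree \<open>sdeg b + 1\<close> of
  \<open>fmor F b\<close>, which \<open>CH_mu\<close> contributes.\<close>

lemma trans_M1_CH:
  fixes as :: "('o, 'b::ab_group_add) arrow list"
  shows "trans_M1 C (CH s) n F G T X as =
     dg_diff (fobj G (string_end X as)) (fobj F X) (sdeg as + n) (T X as)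
   + (\<Sum>(b, c)\<in>splits2 as - {([], as)}.
        ksign (n * sdeg b + 1) (dg_comp (fmor F b) (sdeg c + n) (T (string_end X b) c)))
   + (\<Sum>(c, d)\<in>splits2 as - {(as, [])}.
        ksign (sdeg c + n) (dg_comp (T X c) (sdeg d + 1) (fmor G d)))
   - ksign (n - 1)
       (\<Sum>(b, c, d)\<in>inner_splits as. ksign (sdeg b) (T X (b @ mu_arrow C c # d)))"
proof -
  define h where "h b c bs ds = ksign ((n - 1) * sdeg b)
      (CH_mu (map (fun_arrow F) bs @ trans_arrow n F G T (string_end X b) c
         # map (fun_arrow G) ds))" for b c :: "('o, 'b) arrow list" and bs ds
  define g where "g b c d = (\<Sum>bs\<in>blocks b. \<Sum>ds\<in>blocks d. h b c bs ds)" for b c d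
  have h0: "h b c bs ds = 0" if "length bs + length ds \<ge> 2" for b c bs ds
    using that unfolding h_def by (subst CH_mu_long) auto
  have g0: "g b c d = 0" if "b \<noteq> []" "d \<noteq> []" for b c d
  proof -
    have "h b c bs ds = 0" if "bs \<in> blocks b" "ds \<in> blocks d" for bs ds
    proof (rule h0)
      have "bs \<noteq> []" "ds \<noteq> []"
        using that \<open>b \<noteq> []\<close> \<open>d \<noteq> []\<close> by (auto simp: blocks_def)
      then show "length bs + length ds \<ge> 2"
        by (cases bs; cases ds) auto
    qed
    then show ?thesis
      by (simp add: g_def)
  qed
  have gb: "g b c [] = h b c [b] []" if "b \<noteq> []" for b c
    unfolding g_def using that by (simp add: sum_blocks_one h0)
  have gd: "g [] c d = h [] c [] [d]" if "d \<noteq> []" for c d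
    unfolding g_def using that by (simp add: sum_blocks_one h0)
  have "(\<Sum>(b, c, d)\<in>splits3 as. g b c d) = g [] as []
      + (\<Sum>(b, c)\<in>splits2 as - {([], as)}. g b c [])
      + (\<Sum>(c, d)\<in>splits2 as - {(as, [])}. g [] c d)"
    by (subst sum_splits3_one_sided) (auto simp: g0)
  also have "g [] as [] = dg_diff (fobj G (string_end X as)) (fobj F X) (sdeg as + n) (T X as)"
    by (simp add: g_def h_def trans_arrow_def string_end_def)
  also have "(\<Sum>(b, c)\<in>splits2 as - {([], as)}. g b c []) =
     (\<Sum>(b, c)\<in>splits2 as - {([], as)}.
        ksign (n * sdeg b + 1) (dg_comp (fmor F b) (sdeg c + n) (T (string_end X b) c)))"
  proof (intro sum.cong refl)
    fix p assume p: "p \<in> splits2 as - {([], as)}"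
    obtain b c where bc: "p = (b, c)" by (cases p)
    have "b \<noteq> []"
      using p by (auto simp: bc splits2_def)
    then show "(case p of (b, c) \<Rightarrow> g b c []) = (case p of (b, c) \<Rightarrow>
        ksign (n * sdeg b + 1) (dg_comp (fmor F b) (sdeg c + n) (T (string_end X b) c)))"
      by (auto simp: bc gb h_def trans_arrow_def fun_arrow_def intro!: ksign_parity)
  qed
  also have "(\<Sum>(c, d)\<in>splits2 as - {(as, [])}. g [] c d) =
     (\<Sum>(c, d)\<in>splits2 as - {(as, [])}.
        ksign (sdeg c + n) (dg_comp (T X c) (sdeg d + 1) (fmor G d)))"
  proof (intro sum.cong refl)
    fix p assume p: "p \<in> splits2 as - {(as, [])}"
    obtain c d where cd: "p = (c, d)" by (cases p)
    have "d \<noteq> []"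
      using p by (auto simp: cd splits2_def)
    then show "(case p of (c, d) \<Rightarrow> g [] c d) = (case p of (c, d) \<Rightarrow>
        ksign (sdeg c + n) (dg_comp (T X c) (sdeg d + 1) (fmor G d)))"
      by (simp add: cd gd h_def trans_arrow_def fun_arrow_def)
  qed
  finally show ?thesis
    unfolding g_def h_def trans_M1_def CH_simps by (simp only:)
qed

text \<open>The two transformations already fill both inputs of m_2, leaving no place for functor
  blocks. The Koszul exponent \<open>- sdeg c\<close> cancels the degree \<open>sdeg c\<close> of
  the first transformation, so no sign remains.\<close>

lemma trans_M2_CH:
  fixes as :: "('o, 'b) arrow list"
  shows "trans_M2 (CH s) 0 0 F G H N N' X as =
     (\<Sum>(c, e)\<in>splits2 as. dg_comp (N X c) (sdeg e) (N' (string_end X c) e))"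
proof -
  define h where "h b c d e bs ds fs =
      (CH_mu (map (fun_arrow F) bs
                 @ trans_arrow 0 F G N (string_end X b) c # map (fun_arrow G) ds
                 @ trans_arrow 0 G H N' (string_end X (b @ c @ d)) e # map (fun_arrow H) fs))"
    for b c d e :: "('o, 'b) arrow list" and bs ds fs
  define g where "g = (\<lambda>(b, c, d, e, f). \<Sum>bs\<in>blocks b. \<Sum>ds\<in>blocks d. \<Sum>fs\<in>blocks f.
        ksign ((0 - 1) * sdeg b + (0 - 1) * (sdeg b + sdeg c + sdeg d)) (h b c d e bs ds fs))"
  have h0: "h b c d e bs ds fs = 0" if "bs \<noteq> [] \<or> ds \<noteq> [] \<or> fs \<noteq> []" for b c d e bs ds fs
    unfolding h_def by (rule CH_mu_long) (use that in \<open>auto simp: neq_Nil_conv\<close>)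
  have g0: "g (b, c, d, e, f) = 0" if "b \<noteq> [] \<or> d \<noteq> [] \<or> f \<noteq> []" for b c d e f
  proof -
    have "h b c d e bs ds fs = 0" if "bs \<in> blocks b" "ds \<in> blocks d" "fs \<in> blocks f" for bs ds fs
      by (rule h0) (use that \<open>b \<noteq> [] \<or> d \<noteq> [] \<or> f \<noteq> []\<close> in \<open>auto simp: blocks_def\<close>)
    then show ?thesis
      by (simp add: g_def)
  qed
  have "sum g (splits5 as) = sum g ((\<lambda>(c, e). ([], c, [], e, [])) ` splits2 as)"
  proof (rule sum.mono_neutral_right)
    show "\<forall>p\<in>splits5 as - (\<lambda>(c, e). ([], c, [], e, [])) ` splits2 as. g p = 0"
    proof
      fix p assume p: "p \<in> splits5 as - (\<lambda>(c, e). ([], c, [], e, [])) ` splits2 as"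
      obtain b c d e f where bcd: "p = (b, c, d, e, f)" by (cases p)
      have "b \<noteq> [] \<or> d \<noteq> [] \<or> f \<noteq> []"
        using p unfolding bcd by (force simp: splits5_def splits2_def)
      then show "g p = 0"
        using g0 bcd by simp
    qed
  qed (simp add: finite_splits5, auto simp: splits5_def splits2_def)
  also have "\<dots> = (\<Sum>(c, e)\<in>splits2 as. g ([], c, [], e, []))"
    by (subst sum.reindex) (auto simp: inj_on_def case_prod_beta)
  also have "\<dots> = (\<Sum>(c, e)\<in>splits2 as. dg_comp (N X c) (sdeg e) (N' (string_end X c) e))"
    by (simp add: g_def h_def trans_arrow_def)
  finally show ?thesis
    by (simp add: trans_M2_def g_def h_def)
qed

section \<open>Strings in an \<open>A\<^sub>\<infinity>\<close>-category\<close>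

lemma is_string_end: "is_string C X as Y \<Longrightarrow> string_end X as = Y"
  by (induction as arbitrary: X) auto

lemma is_string_Obj: "is_string C X as Y \<Longrightarrow> X \<in> Obj C \<and> Y \<in> Obj C"
  by (induction as arbitrary: X) auto

lemma is_string_append:
  "is_string C X (as @ bs) Y \<longleftrightarrow>
     is_string C X as (string_end X as) \<and> is_string C (string_end X as) bs Y"
proof (induction as arbitrary: X)
  case Nil
  then show ?case
    using is_string_Obj by fastforce
qed auto

lemma src_hd_string: "is_string C X as Y \<Longrightarrow> as \<noteq> [] \<Longrightarrow> src (hd as) = X"
  by (cases as) auto

lemma tgt_last_string: "is_string C X as Y \<Longrightarrow> as \<noteq> [] \<Longrightarrow> tgt (last as) = Y"
  using is_string_end [of C X as Y] by (simp add: string_end_def)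

section \<open>Linearity and degrees in a fixed A-infinity category\<close>

locale ainf_cat =
  fixes C :: "('k::comm_ring_1, 'o, 'a::ab_group_add) ainf_cat"
  assumes ainf: "ainf_category C"
begin

sublocale module "scl C"
  using ainf by (simp add: ainf_category_def)

lemma subspace_Hom: "X \<in> Obj C \<Longrightarrow> Y \<in> Obj C \<Longrightarrow> subspace (Hom C X Y n)"
  using ainf by (simp add: ainf_category_def)

lemma Hom_add: "X \<in> Obj C \<Longrightarrow> Y \<in> Obj C \<Longrightarrow> x \<in> Hom C X Y n \<Longrightarrow> y \<in> Hom C X Y n \<Longrightarrow>
    x + y \<in> Hom C X Y n"
  by (rule subspace_add [OF subspace_Hom])

lemma Hom_scl: "X \<in> Obj C \<Longrightarrow> Y \<in> Obj C \<Longrightarrow> x \<in> Hom C X Y n \<Longrightarrow> scl C c x \<in> Hom C X Y n"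
  by (rule subspace_scale [OF subspace_Hom])

lemma Hom_zero: "X \<in> Obj C \<Longrightarrow> Y \<in> Obj C \<Longrightarrow> 0 \<in> Hom C X Y n"
  by (rule subspace_0 [OF subspace_Hom])

lemma Hom_minus: "X \<in> Obj C \<Longrightarrow> Y \<in> Obj C \<Longrightarrow> x \<in> Hom C X Y n \<Longrightarrow> - x \<in> Hom C X Y n"
  by (rule subspace_neg [OF subspace_Hom])

lemma Hom_diff: "X \<in> Obj C \<Longrightarrow> Y \<in> Obj C \<Longrightarrow> x \<in> Hom C X Y n \<Longrightarrow> y \<in> Hom C X Y n \<Longrightarrow>
    x - y \<in> Hom C X Y n"
  by (rule subspace_diff [OF subspace_Hom])

lemma mu_Hom: "is_string C X as Y \<Longrightarrow> as \<noteq> [] \<Longrightarrow> mu C as \<in> Hom C X Y (sdeg as + 2)"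
  using ainf by (simp add: ainf_category_def)

lemma ainf_relation: "is_string C X as Y \<Longrightarrow> as \<noteq> [] \<Longrightarrow>
    (\<Sum>(b, c, d)\<in>inner_splits as. ksign (sdeg b) (mu C (b @ mu_arrow C c # d))) = 0"
  using ainf unfolding ainf_category_def by blast

lemma multilinear_mu: "X \<in> Obj C \<Longrightarrow> multilinear_from C (scl C) X (mu C)"
  using ainf by (simp add: ainf_category_def)

lemma mu_add:
  assumes "is_string C X (as @ Arrow S T n x # bs) Y" "is_string C X (as @ Arrow S T n y # bs) Y"
  shows "mu C (as @ Arrow S T n (x + y) # bs)
    = mu C (as @ Arrow S T n x # bs) + mu C (as @ Arrow S T n y # bs)"
  using multilinear_mu [of X] is_string_Obj [OF assms(1)] assms
  unfolding multilinear_from_def by blast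

lemma mu_scl:
  assumes "is_string C X (as @ Arrow S T n x # bs) Y"
  shows "mu C (as @ Arrow S T n (scl C c x) # bs) = scl C c (mu C (as @ Arrow S T n x # bs))"
  using multilinear_mu [of X] is_string_Obj [OF assms(1)] assms
  unfolding multilinear_from_def by blast

lemma mu_zero:
  assumes "is_string C X (as @ Arrow S T n x # bs) Y"
  shows "mu C (as @ Arrow S T n 0 # bs) = 0"
  using mu_scl [OF assms, of 0] by simp

lemma mu_zero_single: "X \<in> Obj C \<Longrightarrow> Y \<in> Obj C \<Longrightarrow> mu C [Arrow X Y n 0] = 0"
  using mu_zero [of X "[]" X Y n 0 "[]" Y] by (simp add: Hom_zero)

lemma mu_minus:
  assumes "is_string C X (as @ Arrow S T n x # bs) Y"
  shows "mu C (as @ Arrow S T n (- x) # bs) = - mu C (as @ Arrow S T n x # bs)"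
  using mu_scl [OF assms, of "- 1"] by simp

lemma mu_diff:
  assumes "is_string C X (as @ Arrow S T n x # bs) Y" "is_string C X (as @ Arrow S T n y # bs) Y"
  shows "mu C (as @ Arrow S T n (x - y) # bs)
    = mu C (as @ Arrow S T n x # bs) - mu C (as @ Arrow S T n y # bs)"
proof -
  have "y \<in> Hom C S T n" "S \<in> Obj C" "T \<in> Obj C"
    using assms(2) is_string_Obj by (fastforce simp: is_string_append)+
  then have "is_string C X (as @ Arrow S T n (- y) # bs) Y"
    using assms(2) by (simp add: is_string_append Hom_minus)
  from mu_add [OF assms(1) this] show ?thesis
    by (simp add: mu_minus [OF assms(2)])
qed

lemma mu_ksign:
  assumes "is_string C X (as @ Arrow S T n x # bs) Y"
  shows "mu C (as @ Arrow S T n (ksign e x) # bs) = ksign e (mu C (as @ Arrow S T n x # bs))"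
  using mu_minus [OF assms] by (simp add: ksign_def)

lemma ksign_Hom: "X \<in> Obj C \<Longrightarrow> Y \<in> Obj C \<Longrightarrow> x \<in> Hom C X Y n \<Longrightarrow> ksign e x \<in> Hom C X Y n"
  using Hom_minus by (simp add: ksign_def)

lemma scl_ksign: "scl C c (ksign e x) = ksign e (scl C c x)"
  by (simp add: ksign_def)

end

section \<open>Transformations between Yoneda functors given by a tail\<close>

text \<open>The sign is the Koszul sign for moving \<open>t\<close> to the left of \<open>as\<close> and \<open>y\<close>, in shifted degrees.\<close>

definition tail_trans ::
  "('k, 'o, 'a::ab_group_add, 'z) ainf_cat_scheme \<Rightarrow> 'o \<Rightarrow> ('o, 'a) arrow list
     \<Rightarrow> ('o, 'a, int \<Rightarrow> 'a \<Rightarrow> 'a) pretrans" where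
  "tail_trans C L t X as = (\<lambda>i y.
     if y \<in> Hom C (string_end X as) L i
     then ksign (sdeg t * (sdeg as + i - 1)) (mu C (as @ Arrow (string_end X as) L i y # t))
     else 0)"

lemma yoneda_complex_simps [simp]:
  "cgr (yoneda_complex C L X) = Hom C X L"
  "cdiff (yoneda_complex C L X) n y = (if y \<in> Hom C X L n then - mu C [Arrow X L n y] else 0)"
  by (simp_all add: yoneda_complex_def)

lemma fobj_yoneda [simp]: "fobj (yoneda C L) = yoneda_complex C L"
  by (simp add: yoneda_def)

text \<open>The empty tail has sign exponent 0, so the Yoneda functor is itself an instance of
  \<open>tail_trans\<close> and inherits degree, linearity and multilinearity from it. The object
  \<open>X\<close> is free because the end of a nonempty string does not depend on it.\<close>

lemma fmor_yoneda: "as \<noteq> [] \<Longrightarrow> fmor (yoneda C L) as = tail_trans C L [] X as"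
  by (simp add: yoneda_def tail_trans_def string_end_def fun_eq_iff)

context ainf_cat
begin

lemma is_string_insert:
  assumes "is_string C X as Y" "is_string C L t L'" "y \<in> Hom C Y L i"
  shows "is_string C X (as @ Arrow Y L i y # t) L'"
  using assms is_string_Obj [OF assms(1)] is_string_end [OF assms(1)]
  by (simp add: is_string_append)

text \<open>The degree is bracketed as \<open>i\<close> plus the degree of the map, the form that
  \<open>dg_hom\<close> asks for.\<close>

lemma mu_insert_Hom:
  assumes "is_string C X as Y" "is_string C L t L'" "y \<in> Hom C Y L i"
  shows "mu C (as @ Arrow Y L i y # t) \<in> Hom C X L' (i + (sdeg as + (sdeg t + 1)))"
proof -
  have "sdeg (as @ Arrow Y L i y # t) + 2 = i + (sdeg as + (sdeg t + 1))"
    by simp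
  then show ?thesis
    using mu_Hom [OF is_string_insert [OF assms]] by (metis append_is_Nil_conv list.distinct(1))
qed

lemma linear_between_minus:
  assumes "linear_between (scl C) V W f" "x \<in> V" "- x \<in> V"
  shows "f (- x) = - f x"
proof -
  have "f (scl C (- 1) x) = scl C (- 1) (f x)"
    using assms unfolding linear_between_def by blast
  then show ?thesis
    by simp
qed

text \<open>If 0 lies outside the domain, the default value of maps off their domain gives the
  claim.\<close>

lemma linear_between_zero:
  assumes "linear_between (scl C) V W f"
  shows "f 0 = 0"
proof (cases "0 \<in> V")
  case True
  then have "f (scl C 0 0) = scl C 0 (f 0)"
    using assms unfolding linear_between_def by blast
  then show ?thesis
    by simp
qed (use assms in \<open>simp add: linear_between_def\<close>)

lemma tail_trans_eq:
  assumes "is_string C X as Y" "y \<in> Hom C Y L i"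
  shows "tail_trans C L t X as i y
    = ksign (sdeg t * (sdeg as + i - 1)) (mu C (as @ Arrow Y L i y # t))"
  using assms is_string_end [OF assms(1)] by (simp add: tail_trans_def)

lemma tail_trans_dg_hom:
  assumes as: "is_string C X as Y" and t: "is_string C L t L'"
  shows "tail_trans C L t X as
    \<in> dg_hom (scl C) (yoneda_complex C L Y) (yoneda_complex C L' X) (sdeg as + (sdeg t + 1))"
proof -
  have Obj: "X \<in> Obj C" "Y \<in> Obj C" "L \<in> Obj C" "L' \<in> Obj C"
    using is_string_Obj [OF as] is_string_Obj [OF t] by simp_all
  have "linear_between (scl C) (Hom C Y L i) (Hom C X L' (i + (sdeg as + (sdeg t + 1))))
     (tail_trans C L t X as i)" for i
    unfolding linear_between_def
  proof (intro conjI ballI allI impI)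
    fix x assume x: "x \<in> Hom C Y L i"
    note s = is_string_insert [OF as t]
    show "tail_trans C L t X as i x \<in> Hom C X L' (i + (sdeg as + (sdeg t + 1)))"
      unfolding tail_trans_eq [OF as x]
      by (rule ksign_Hom) (use Obj x mu_insert_Hom [OF as t] in auto)
    show "tail_trans C L t X as i (scl C c x) = scl C c (tail_trans C L t X as i x)" for c
      by (simp add: tail_trans_eq [OF as] x Hom_scl Obj mu_scl [OF s [OF x]] scl_ksign)
    fix y assume y: "y \<in> Hom C Y L i"
    show "tail_trans C L t X as i (x + y) = tail_trans C L t X as i x + tail_trans C L t X as i y"
      by (simp add: tail_trans_eq [OF as] x y Hom_add Obj mu_add [OF s [OF x] s [OF y]] ksign_add)
  next
    fix x assume "x \<notin> Hom C Y L i"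
    then show "tail_trans C L t X as i x = 0"
      using is_string_end [OF as] by (simp add: tail_trans_def)
  qed
  then show ?thesis
    by (simp add: dg_hom_def)
qed

lemma multilinear_tail_trans:
  assumes t: "is_string C L t L'"
  shows "multilinear_from C (scl (CH (scl C))) X (tail_trans C L t X)"
  unfolding multilinear_from_def
proof (intro allI impI conjI ext)
  fix as S T n x y c bs Y
  assume a: "is_string C X (as @ Arrow S T n x # bs) Y \<and> is_string C X (as @ Arrow S T n y # bs) Y"
  have e: "string_end T bs = Y"
    using a is_string_end by fastforce
  have ins: "is_string C X (as @ Arrow S T n x # bs @ Arrow Y L i z # t) L'"
    "is_string C X (as @ Arrow S T n y # bs @ Arrow Y L i z # t) L'"
    if "z \<in> Hom C Y L i" for i z
    using a is_string_insert [OF _ t that] by fastforce+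
  show "tail_trans C L t X (as @ Arrow S T n (x + y) # bs) i z
     = (tail_trans C L t X (as @ Arrow S T n x # bs)
        + tail_trans C L t X (as @ Arrow S T n y # bs)) i z" for i z
    by (simp add: tail_trans_def e mu_add [OF ins] ksign_add)
  show "tail_trans C L t X (as @ Arrow S T n (scl C c x) # bs) i z
     = scl (CH (scl C)) c (tail_trans C L t X (as @ Arrow S T n x # bs)) i z" for i z
    by (simp add: tail_trans_def e mu_scl [OF ins(1)] scl_ksign)
qed

text \<open>Appending \<open>t\<close> sends Hom(Y,L') to Hom(X,L). Arrows of \<open>CH\<close> run
  against maps of complexes, so the result goes from the Yoneda functor of \<open>L\<close> to that
  of \<open>L'\<close>.\<close>

lemma pre_natural_tail_trans:
  assumes t: "is_string C L' t L"
  shows "pre_natural C (CH (scl C)) (sdeg t + 1) (yoneda C L) (yoneda C L') (tail_trans C L' t)"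
  unfolding pre_natural_def
  using tail_trans_dg_hom [OF _ t] multilinear_tail_trans [OF t] by simp

section \<open>The Yoneda functor as an A-infinity functor\<close>

lemma is_complex_yoneda:
  assumes "X \<in> Obj C" "L \<in> Obj C"
  shows "is_complex (scl C) (yoneda_complex C L X)"
proof -
  have lin: "linear_between (scl C) (Hom C X L n) (Hom C X L (n + 1))
      (\<lambda>y. - tail_trans C L [] X [] n y)" for n
  proof -
    have "linear_between (scl C) (Hom C X L n) (Hom C X L (n + 1)) (tail_trans C L [] X [] n)"
      using tail_trans_dg_hom [of X "[]" X L "[]" L] assms by (simp add: dg_hom_def)
    then show ?thesis
      using assms by (auto simp: linear_between_def Hom_minus)
  qed
  have cd: "cdiff (yoneda_complex C L X) n = (\<lambda>y. - tail_trans C L [] X [] n y)" for n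
    by (auto simp: tail_trans_def)
  have sq: "cdiff (yoneda_complex C L X) (n + 1) (cdiff (yoneda_complex C L X) n y) = 0"
    if y: "y \<in> Hom C X L n" for n y
  proof -
    have s: "is_string C X [Arrow X L n y] L"
      using assms y by simp
    have m: "mu C [Arrow X L n y] \<in> Hom C X L (n + 1)"
      using mu_Hom [OF s] by (simp add: add.commute)
    \<comment> \<open>For a single input the A-infinity relation has one term and reads m_1 m_1 = 0;
      the minus signs of \<open>cdiff\<close> then come out by linearity.\<close>
    have "mu C [mu_arrow C [Arrow X L n y]] = 0"
      using ainf_relation [OF s] by simp
    then have "mu C [Arrow X L (n + 1) (mu C [Arrow X L n y])] = 0"
      by (simp add: mu_arrow_def add.commute)
    then show ?thesis
      using y m assms mu_minus [of X "[]" X L "n + 1" "mu C [Arrow X L n y]" "[]" L]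
      by (simp add: Hom_minus)
  qed
  show ?thesis
    unfolding is_complex_def using sq lin assms by (simp add: cd subspace_Hom)
qed

lemma mu_arrow_insert:
  assumes "is_string C X as Y" "is_string C L t L'" "y \<in> Hom C Y L i"
  shows "mu_arrow C (as @ Arrow Y L i y # t)
    = Arrow X L' (i + (sdeg as + (sdeg t + 1))) (mu C (as @ Arrow Y L i y # t))"
  using src_hd_string [OF is_string_insert [OF assms]] tgt_last_string [OF is_string_insert [OF assms]]
  by (simp add: mu_arrow_def)

lemma mu_arrow_string:
  assumes "is_string C X as Y" "as \<noteq> []"
  shows "mu_arrow C as = Arrow X Y (sdeg as + 2) (mu C as)"
  using src_hd_string [OF assms] tgt_last_string [OF assms] by (simp add: mu_arrow_def)

lemma is_string_mu_arrow:
  assumes "is_string C X (b @ c @ d) Y" "c \<noteq> []"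
  shows "is_string C X (b @ mu_arrow C c # d) Y"
    and "sdeg (b @ mu_arrow C c # d) = sdeg (b @ c @ d) + 1"
proof -
  have c: "is_string C (string_end X b) c (string_end X (b @ c))"
    and b: "is_string C X b (string_end X b)" and d: "is_string C (string_end X (b @ c)) d Y"
    using assms(1) by (simp_all add: is_string_append)
  show "is_string C X (b @ mu_arrow C c # d) Y"
    using b d mu_Hom [OF c assms(2)] is_string_Obj [OF c]
    by (simp add: is_string_append mu_arrow_string [OF c assms(2)])
  show "sdeg (b @ mu_arrow C c # d) = sdeg (b @ c @ d) + 1"
    by (simp add: mu_arrow_def)
qed

lemma splits2_strings:
  assumes "is_string C X as Y" "(b, c) \<in> splits2 as"
  shows "is_string C X b (string_end X b)" "is_string C (string_end X b) c Y"
    "sdeg as = sdeg b + sdeg c"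
  using assms by (auto simp: splits2_def is_string_append)

text \<open>The relation is sorted by the position of the inner operation with respect to
  \<open>y\<close>. In the last sum the exponent contains \<open>i - 1\<close>, the shifted degree
  of \<open>y\<close>, which there stands to the left of the inner operation.\<close>

lemma ainf_relation_tail:
  assumes as: "is_string C X as Y" and t: "is_string C L t L'" and y: "y \<in> Hom C Y L i"
  shows "(\<Sum>(b, c, d)\<in>inner_splits as.
            ksign (sdeg b) (mu C (b @ mu_arrow C c # d @ Arrow Y L i y # t)))
       + (\<Sum>(b, c)\<in>splits2 as. \<Sum>(u, v)\<in>splits2 t.
            ksign (sdeg b) (mu C (b @ mu_arrow C (c @ Arrow Y L i y # u) # v)))
       + (\<Sum>(u, c, d)\<in>inner_splits t.
            ksign (sdeg as + (i - 1) + sdeg u) (mu C (as @ Arrow Y L i y # u @ mu_arrow C c # d))) = 0"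
  using ainf_relation [OF is_string_insert [OF assms]]
  by (simp add: sum_inner_splits_append add.assoc)

text \<open>This is the A-infinity relation for \<open>as\<close> followed by \<open>y\<close>. The
  terms in which the inner operation contains \<open>y\<close> make up the left side with opposite
  sign, and the other terms the right side.\<close>

lemma yoneda_functor_equation:
  assumes as: "is_string C X as Y" "as \<noteq> []" and y: "y \<in> Hom C Y L i" and L: "L \<in> Obj C"
  shows "(\<Sum>bs\<in>blocks as. CH_mu (map (fun_arrow (yoneda C L)) bs)) i y
    = (\<Sum>(b, c, d)\<in>inner_splits as. ksign (sdeg b) (fmor (yoneda C L) (b @ mu_arrow C c # d))) i y"
proof -
  let ?F = "yoneda C L" and ?y = "Arrow Y L i y"
  let ?h = "\<lambda>(b, c). ksign (sdeg b) (mu C (b @ [mu_arrow C (c @ [?y])]))"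
  have nil: "is_string C L [] L"
    using L by simp
  note ins = mu_insert_Hom [OF _ nil, simplified] mu_arrow_insert [OF _ nil, simplified]
  have fm: "fmor ?F c j z = mu C (c @ [Arrow Y' L j z])"
    if "is_string C X' c Y'" "c \<noteq> []" "z \<in> Hom C Y' L j" for c j z X' Y'
    using that by (simp add: fmor_yoneda [where X = X'] tail_trans_eq)
  have Y: "Y \<in> Obj C" "X \<in> Obj C"
    using is_string_Obj [OF as(1)] by simp_all
  \<comment> \<open>Since \<open>as\<close> is nonempty, these two splittings differ; they are the
    ones which no pair of blocks supplies.\<close>
  have mem: "([], as) \<in> splits2 as" "(as, []) \<in> splits2 as - {([], as)}"
    using as(2) by (auto simp: splits2_def)
  have my: "mu C [?y] \<in> Hom C Y L (i + 1)" "mu_arrow C [?y] = Arrow Y L (i + 1) (mu C [?y])"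
    using ins [of Y "[]" Y] Y y by simp_all
  \<comment> \<open>The two halves of \<open>dg_diff\<close> give the two extreme splittings: m_1
    applied last, and m_1 applied to \<open>y\<close> first.\<close>
  have 1: "CH_mu [fun_arrow ?F as] i y = - ?h ([], as) - ?h (as, [])"
  proof -
    have "fmor ?F as (i + 1) (- mu C [?y]) = - mu C (as @ [mu_arrow C [?y]])"
      using my mu_minus [of X as Y L "i + 1" "mu C [?y]" "[]" L] is_string_insert [OF as(1) nil my(1)]
      by (simp add: fm [OF as] Hom_minus Y L)
    moreover have "mu C (as @ [?y]) \<in> Hom C X L (i + (sdeg as + 1))"
      using ins(1) [OF as(1) y] .
    ultimately show ?thesis
      using y as ins(2) [OF as(1) y] src_hd_string [OF as] tgt_last_string [OF as]
      by (simp add: fun_arrow_def dg_diff_def fm [OF as y] ksign_plus_one ksign_minus)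
  qed
  \<comment> \<open>The degree \<open>sdeg b + 1\<close> of the first factor turns the sign of m_2
    into minus the sign in the A-infinity relation.\<close>
  have 2: "CH_mu [fun_arrow ?F b, fun_arrow ?F c] i y = - ?h (b, c)"
    if bc: "(b, c) \<in> splits2 as - {([], as), (as, [])}" for b c
  proof -
    have ne: "b \<noteq> []" "c \<noteq> []"
      using bc by (auto simp: splits2_def)
    have b: "is_string C X b (string_end X b)" and c: "is_string C (string_end X b) c Y"
      using splits2_strings [OF as(1)] bc by blast+
    show ?thesis
      using ins [OF c y]
      by (simp add: fun_arrow_def dg_comp_def fm [OF c ne(2) y] fm [OF b ne(1)] ksign_apply
          ksign_plus_one)
  qed
  have "(\<Sum>bs\<in>blocks as. CH_mu (map (fun_arrow ?F) bs)) =
      CH_mu [fun_arrow ?F as]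
      + (\<Sum>(b, c)\<in>splits2 as - {([], as), (as, [])}. CH_mu [fun_arrow ?F b, fun_arrow ?F c])"
    by (subst sum_blocks_two) (auto simp: CH_mu_long as)
  moreover have "(\<Sum>(b, c)\<in>splits2 as - {([], as), (as, [])}.
        CH_mu [fun_arrow ?F b, fun_arrow ?F c]) i y
      = (\<Sum>p\<in>splits2 as - {([], as), (as, [])}. - ?h p)"
    unfolding sum_apply
  proof (intro sum.cong refl)
    fix p assume p: "p \<in> splits2 as - {([], as), (as, [])}"
    obtain b c where bc: "p = (b, c)" by (cases p)
    show "(case p of (b, c) \<Rightarrow> CH_mu [fun_arrow ?F b, fun_arrow ?F c]) i y = - ?h p"
      using 2 [of b c] p by (simp add: bc del: CH_mu.simps)
  qed
  ultimately have "(\<Sum>bs\<in>blocks as. CH_mu (map (fun_arrow ?F) bs)) i y =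
      CH_mu [fun_arrow ?F as] i y
      + (\<Sum>p\<in>splits2 as - {([], as), (as, [])}. - ?h p)"
    by (simp del: CH_mu.simps)
  also have "\<dots> = - (\<Sum>p\<in>splits2 as. ?h p)"
    using sum.remove [OF _ mem(1), of ?h] sum.remove [OF _ mem(2), of ?h]
    by (simp add: 1 sum_negf insert_commute flip: Diff_insert del: CH_mu.simps)
  also have "\<dots> = (\<Sum>(b, c, d)\<in>inner_splits as. ksign (sdeg b) (mu C (b @ mu_arrow C c # d @ [?y])))"
    using ainf_relation_tail [OF as(1) nil y] by (simp add: case_prod_beta neg_eq_iff_add_eq_0 add.commute)
  also have "\<dots> = (\<Sum>(b, c, d)\<in>inner_splits as. ksign (sdeg b) (fmor ?F (b @ mu_arrow C c # d))) i y"
    unfolding sum_apply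
  proof (intro sum.cong refl)
    fix p assume p: "p \<in> inner_splits as"
    obtain b c d where bcd: "p = (b, c, d)" by (cases p)
    have s: "is_string C X (b @ mu_arrow C c # d) Y"
      using p as by (intro is_string_mu_arrow) (auto simp: inner_splits_def bcd)
    show "(case p of (b, c, d) \<Rightarrow> ksign (sdeg b) (mu C (b @ mu_arrow C c # d @ [?y])))
      = (case p of (b, c, d) \<Rightarrow> ksign (sdeg b) (fmor ?F (b @ mu_arrow C c # d))) i y"
      using fm [OF s _ y] by (simp add: bcd ksign_apply)
  qed
  finally show ?thesis .
qed

lemma fmor_yoneda_outside:
  assumes "is_string C X as Y" "as \<noteq> []" "y \<notin> Hom C Y L i"
  shows "fmor (yoneda C L) as i y = 0"
  using assms is_string_end [OF assms(1)] by (simp add: fmor_yoneda [where X = X] tail_trans_def)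

text \<open>Off the domain of the inner factor a composite evaluates the outer factor at 0, which is
  why this value matters.\<close>

lemma fmor_yoneda_zero:
  assumes "is_string C X as Y" "as \<noteq> []" "L \<in> Obj C"
  shows "fmor (yoneda C L) as i 0 = 0"
proof -
  have "is_string C L [] L"
    using assms by simp
  from tail_trans_dg_hom [OF assms(1) this] show ?thesis
    using linear_between_zero by (auto simp: dg_hom_def fmor_yoneda [OF assms(2), where X = X])
qed

lemma ainf_functor_yoneda:
  assumes L: "L \<in> Obj C"
  shows "ainf_functor C (CH (scl C)) (yoneda C L)"
  unfolding ainf_functor_def
proof (intro conjI ballI allI impI)
  have nil: "is_string C L [] L"
    using L by simp
  show "fobj (yoneda C L) X \<in> Obj (CH (scl C))" if "X \<in> Obj C" for X
    using is_complex_yoneda that L by simp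
  show "fmor (yoneda C L) as \<in> Hom (CH (scl C)) (fobj (yoneda C L) X) (fobj (yoneda C L) Y) (sdeg as + 1)"
    if "is_string C X as Y \<and> as \<noteq> []" for X as Y
    using tail_trans_dg_hom [OF _ nil] that by (simp add: fmor_yoneda [where X = X])
  show "multilinear_from C (scl (CH (scl C))) X (fmor (yoneda C L))" for X
    using multilinear_tail_trans [OF nil, of X]
    by (simp add: multilinear_from_def fmor_yoneda [where X = X])
  fix X as Y assume as: "is_string C X as Y \<and> as \<noteq> []"
  have "(\<Sum>bs\<in>blocks as. CH_mu (map (fun_arrow (yoneda C L)) bs)) i y
    = (\<Sum>(b, c, d)\<in>inner_splits as. ksign (sdeg b) (fmor (yoneda C L) (b @ mu_arrow C c # d))) i y"
    for i y
  proof (cases "y \<in> Hom C Y L i")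
    case True
    then show ?thesis
      using yoneda_functor_equation as L by blast
  next
    case False
    \<comment> \<open>The functor equation is one between functions on the whole ambient module, so
      both sides must also vanish where \<open>y\<close> is not in the domain.\<close>
    have "CH_mu (map (fun_arrow (yoneda C L)) bs) i y = 0" if "bs \<in> blocks as" for bs
    proof (cases bs rule: list_length_two_cases)
      case (2 x)
      then have "x = as"
        using that by (auto simp: blocks_def)
      have "src (hd as) = X" "tgt (last as) = Y" "X \<in> Obj C"
        using as src_hd_string tgt_last_string is_string_Obj by fastforce+
      moreover have "fmor (yoneda C L) as i y = 0" "fmor (yoneda C L) as (i + 1) 0 = 0"
        using fmor_yoneda_outside fmor_yoneda_zero as False L by blast+
      ultimately show ?thesis
        using 2 False \<open>x = as\<close> by (simp add: fun_arrow_def dg_diff_def mu_zero_single L)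
    next
      case (3 b c)
      then have ne: "b \<noteq> []" "c \<noteq> []" and bc: "(b, c) \<in> splits2 as"
        using that by (auto simp: blocks_def splits2_def)
      have b: "is_string C X b (string_end X b)" and c: "is_string C (string_end X b) c Y"
        using splits2_strings [OF _ bc] as by blast+
      show ?thesis
        by (simp add: 3 fun_arrow_def dg_comp_def fmor_yoneda_outside [OF c ne(2) False]
            fmor_yoneda_zero [OF b ne(1) L] ksign_apply)
    qed (simp_all add: CH_mu_long)
    moreover have "fmor (yoneda C L) (b @ mu_arrow C c # d) i y = 0"
      if "(b, c, d) \<in> inner_splits as" for b c d
      using fmor_yoneda_outside [OF is_string_mu_arrow(1) _ False, of X b c d] as that
      by (auto simp: inner_splits_def)
    ultimately show ?thesis
      by (auto simp: sum_apply ksign_apply intro!: sum.neutral)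
  qed
  then show "(\<Sum>bs\<in>blocks as. mu (CH (scl C)) (map (fun_arrow (yoneda C L)) bs))
    = (\<Sum>(b, c, d)\<in>inner_splits as. ksign (sdeg b) (fmor (yoneda C L) (b @ mu_arrow C c # d)))"
    by (simp add: fun_eq_iff)
qed

section \<open>The differential of transformations between Yoneda functors\<close>

lemma pre_natural_yoneda_linear:
  assumes "pre_natural C (CH (scl C)) n (yoneda C L) (yoneda C L') T" "is_string C X as Y"
  shows "linear_between (scl C) (Hom C Y L' i) (Hom C X L (i + (sdeg as + n))) (T X as i)"
  using assms by (simp add: pre_natural_def dg_hom_def)

text \<open>The two halves of \<open>dg_diff\<close> supply the extreme splittings missing from the
  sums in \<open>trans_M1_CH\<close>, so that both sums run over all splittings. The final
  \<open>+ 1\<close> in the second exponent gives both sums the same outer minus.\<close>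

lemma trans_M1_yoneda:
  assumes T: "pre_natural C (CH (scl C)) n (yoneda C L) (yoneda C L') T"
    and as: "is_string C X as Y" and y: "y \<in> Hom C Y L' i"
    and L: "L \<in> Obj C" "L' \<in> Obj C"
  shows "trans_M1 C (CH (scl C)) n (yoneda C L) (yoneda C L') T X as i y =
    - (\<Sum>(b, c)\<in>splits2 as. ksign (n * sdeg b)
         (mu C (b @ [Arrow (string_end X b) L (i + (sdeg c + n)) (T (string_end X b) c i y)])))
    - (\<Sum>(c, d)\<in>splits2 as. ksign (sdeg c + n + 1)
         (T X c (i + (sdeg d + 1)) (mu C (d @ [Arrow Y L' i y]))))
    - ksign (n - 1) (\<Sum>(b, c, d)\<in>inner_splits as.
         ksign (sdeg b) (T X (b @ mu_arrow C c # d) i y))"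
proof -
  let ?F = "yoneda C L" and ?G = "yoneda C L'"
  let ?h = "\<lambda>(b, c). ksign (n * sdeg b)
         (mu C (b @ [Arrow (string_end X b) L (i + (sdeg c + n)) (T (string_end X b) c i y)]))"
  let ?k = "\<lambda>(c, d). ksign (sdeg c + n + 1)
         (T X c (i + (sdeg d + 1)) (mu C (d @ [Arrow Y L' i y])))"
  have obj: "X \<in> Obj C" "Y \<in> Obj C"
    using is_string_Obj [OF as] by simp_all
  have nil: "is_string C L [] L" "is_string C L' [] L'"
    using L by simp_all
  note lin = pre_natural_yoneda_linear [OF T]
  have T_Hom: "T X' c' j z \<in> Hom C X' L (j + (sdeg c' + n))"
    if "is_string C X' c' Y'" "z \<in> Hom C Y' L' j" for X' c' Y' j z
    using lin [OF that(1)] that(2) by (simp add: linear_between_def)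
  have fm: "fmor (yoneda C M) c j z = mu C (c @ [Arrow Y' M j z])"
    if "is_string C X' c Y'" "c \<noteq> []" "z \<in> Hom C Y' M j" for M c j z X' Y'
    using that by (simp add: fmor_yoneda [where X = X'] tail_trans_eq)
  have my: "mu C [Arrow Y L' i y] \<in> Hom C Y L' (i + 1)"
    using mu_insert_Hom [of Y "[]" Y L' "[]" L' y i] obj L y by simp
  have "dg_diff (fobj ?G (string_end X as)) (fobj ?F X) (sdeg as + n) (T X as) i y
    = - ?h ([], as) - ?k (as, [])"
    using T_Hom [OF as y] y my linear_between_minus [OF lin [OF as] my] obj L
    by (simp add: dg_diff_def is_string_end [OF as] ksign_minus Hom_minus ksign_plus_one)
  moreover have "(\<Sum>(b, c)\<in>splits2 as - {([], as)}.
        ksign (n * sdeg b + 1) (dg_comp (fmor ?F b) (sdeg c + n) (T (string_end X b) c))) i y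
      = (\<Sum>p\<in>splits2 as - {([], as)}. - ?h p)"
    unfolding sum_apply
  proof (intro sum.cong refl)
    fix p assume p: "p \<in> splits2 as - {([], as)}"
    obtain b c where bc: "p = (b, c)" by (cases p)
    have b: "is_string C X b (string_end X b)" and c: "is_string C (string_end X b) c Y"
      and ne: "b \<noteq> []"
      using splits2_strings [OF as] p by (auto simp: bc splits2_def)
    show "(case p of (b, c) \<Rightarrow> ksign (n * sdeg b + 1)
        (dg_comp (fmor ?F b) (sdeg c + n) (T (string_end X b) c))) i y = - ?h p"
      using fm [OF b ne T_Hom [OF c y]] by (simp add: bc ksign_apply dg_comp_def ksign_plus_one)
  qed
  moreover have "(\<Sum>(c, d)\<in>splits2 as - {(as, [])}.
        ksign (sdeg c + n) (dg_comp (T X c) (sdeg d + 1) (fmor ?G d))) i y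
      = (\<Sum>p\<in>splits2 as - {(as, [])}. - ?k p)"
    unfolding sum_apply
  proof (intro sum.cong refl)
    fix p assume p: "p \<in> splits2 as - {(as, [])}"
    obtain c d where cd: "p = (c, d)" by (cases p)
    have d: "is_string C (string_end X c) d Y" and ne: "d \<noteq> []"
      using splits2_strings [OF as] p by (auto simp: cd splits2_def)
    show "(case p of (c, d) \<Rightarrow> ksign (sdeg c + n)
        (dg_comp (T X c) (sdeg d + 1) (fmor ?G d))) i y = - ?k p"
      using fm [OF d ne y] by (simp add: cd ksign_apply dg_comp_def ksign_plus_one)
  qed
  moreover have "sum ?h (splits2 as) = ?h ([], as) + sum ?h (splits2 as - {([], as)})"
    by (rule sum.remove) (auto simp: splits2_def [of as] finite_splits2 [of as, unfolded splits2_def])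
  moreover have "sum ?k (splits2 as) = ?k (as, []) + sum ?k (splits2 as - {(as, [])})"
    by (rule sum.remove) (auto simp: splits2_def [of as] finite_splits2 [of as, unfolded splits2_def])
  moreover have "(\<Sum>(b, c, d)\<in>inner_splits as. ksign (sdeg b) (T X (b @ mu_arrow C c # d))) i y =
      (\<Sum>(b, c, d)\<in>inner_splits as. ksign (sdeg b) (T X (b @ mu_arrow C c # d) i y))"
    by (simp add: sum_apply case_prod_beta ksign_apply)
  ultimately show ?thesis
    by (simp add: trans_M1_CH ksign_apply sum_negf)
qed

text \<open>Transformations are compared as functions, hence off the domain too. There every term
  evaluates its innermost map outside the domain, which gives 0, and any outer map sends 0 to
  0.\<close>

lemma trans_M1_yoneda_outside:
  assumes T: "pre_natural C (CH (scl C)) n (yoneda C L) (yoneda C L') T"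
    and as: "is_string C X as Y" and y: "y \<notin> Hom C Y L' i"
    and L: "L \<in> Obj C" "L' \<in> Obj C"
  shows "trans_M1 C (CH (scl C)) n (yoneda C L) (yoneda C L') T X as i y = 0"
proof -
  let ?F = "yoneda C L" and ?G = "yoneda C L'"
  have obj: "X \<in> Obj C" "Y \<in> Obj C"
    using is_string_Obj [OF as] by simp_all
  have Ty: "T X' c' i y = 0" if "is_string C X' c' Y" for X' c'
    using pre_natural_yoneda_linear [OF T that] y by (simp add: linear_between_def)
  have T0: "T X' c' j 0 = 0" if "is_string C X' c' Y'" for X' c' Y' j
    using pre_natural_yoneda_linear [OF T that] linear_between_zero by blast
  have "dg_diff (fobj ?G (string_end X as)) (fobj ?F X) (sdeg as + n) (T X as) i y = 0"
    using y by (simp add: dg_diff_def is_string_end [OF as] Ty [OF as] T0 [OF as] mu_zero_single obj L)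
  moreover have "(\<Sum>(b, c)\<in>splits2 as - {([], as)}.
        ksign (n * sdeg b + 1) (dg_comp (fmor ?F b) (sdeg c + n) (T (string_end X b) c))) i y = 0"
    unfolding sum_apply
  proof (intro sum.neutral ballI)
    fix p assume p: "p \<in> splits2 as - {([], as)}"
    obtain b c where bc: "p = (b, c)" by (cases p)
    have "is_string C X b (string_end X b)" "is_string C (string_end X b) c Y" "b \<noteq> []"
      using splits2_strings [OF as] p by (auto simp: bc splits2_def)
    then show "(case p of (b, c) \<Rightarrow> ksign (n * sdeg b + 1)
        (dg_comp (fmor ?F b) (sdeg c + n) (T (string_end X b) c))) i y = 0"
      by (simp add: bc ksign_apply dg_comp_def Ty fmor_yoneda_zero L)
  qed
  moreover have "(\<Sum>(c, d)\<in>splits2 as - {(as, [])}.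
        ksign (sdeg c + n) (dg_comp (T X c) (sdeg d + 1) (fmor ?G d))) i y = 0"
    unfolding sum_apply
  proof (intro sum.neutral ballI)
    fix p assume p: "p \<in> splits2 as - {(as, [])}"
    obtain c d where cd: "p = (c, d)" by (cases p)
    have "is_string C X c (string_end X c)" "is_string C (string_end X c) d Y" "d \<noteq> []"
      using splits2_strings [OF as] p by (auto simp: cd splits2_def)
    then show "(case p of (c, d) \<Rightarrow> ksign (sdeg c + n)
        (dg_comp (T X c) (sdeg d + 1) (fmor ?G d))) i y = 0"
      using fmor_yoneda_outside y by (simp add: cd ksign_apply dg_comp_def T0)
  qed
  moreover have "(\<Sum>(b, c, d)\<in>inner_splits as. ksign (sdeg b) (T X (b @ mu_arrow C c # d))) i y = 0"
    unfolding sum_apply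
  proof (intro sum.neutral ballI)
    fix p assume p: "p \<in> inner_splits as"
    obtain b c d where bcd: "p = (b, c, d)" by (cases p)
    have "T X (b @ mu_arrow C c # d) i y = 0"
      using p as by (intro Ty is_string_mu_arrow) (auto simp: bcd inner_splits_def)
    then show "(case p of (b, c, d) \<Rightarrow> ksign (sdeg b) (T X (b @ mu_arrow C c # d))) i y = 0"
      by (simp add: bcd ksign_apply)
  qed
  ultimately show ?thesis
    by (simp add: trans_M1_CH ksign_apply)
qed

text \<open>The sign in \<open>tail_trans\<close> is chosen so that the three sums of
  \<open>trans_M1_yoneda\<close> carry the signs of the A-infinity relation times one common sign
  with exponent \<open>sdeg t * (sdeg as + i - 1)\<close>. What the relation leaves over is then the
  right side.\<close>

lemma trans_M1_tail:
  assumes t: "is_string C L' t L" "t \<noteq> []" and as: "is_string C X as Y" and y: "y \<in> Hom C Y L' i"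
  shows "trans_M1 C (CH (scl C)) (sdeg t + 1) (yoneda C L) (yoneda C L') (tail_trans C L' t) X as i y =
    ksign (sdeg t * (sdeg as + i - 1))
     ((\<Sum>(b, c)\<in>splits2 as. \<Sum>(u, v)\<in>splits2 t - {([], t), (t, [])}.
         ksign (sdeg b) (mu C (b @ mu_arrow C (c @ Arrow Y L' i y # u) # v)))
    + (\<Sum>(u, c, d)\<in>inner_splits t.
         ksign (sdeg as + (i - 1) + sdeg u) (mu C (as @ Arrow Y L' i y # u @ mu_arrow C c # d))))"
proof -
  let ?y = "Arrow Y L' i y" and ?e = "sdeg t * (sdeg as + i - 1)" and ?n = "sdeg t + 1"
  let ?T = "tail_trans C L' t"
  let ?g = "\<lambda>b c (u, v). ksign (sdeg b) (mu C (b @ mu_arrow C (c @ ?y # u) # v))"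
  let ?A = "\<Sum>(b, c, d)\<in>inner_splits as. ksign (sdeg b) (mu C (b @ mu_arrow C c # d @ ?y # t))"
  let ?R = "\<Sum>(b, c)\<in>splits2 as. \<Sum>p\<in>splits2 t - {([], t), (t, [])}. ?g b c p"
  let ?C = "\<Sum>(u, c, d)\<in>inner_splits t.
         ksign (sdeg as + (i - 1) + sdeg u) (mu C (as @ ?y # u @ mu_arrow C c # d))"
  have L: "L \<in> Obj C" "L' \<in> Obj C" and obj: "X \<in> Obj C" "Y \<in> Obj C"
    using is_string_Obj [OF t(1)] is_string_Obj [OF as] by simp_all
  have nil: "is_string C L [] L" "is_string C L' [] L'"
    using L by simp_all
  \<comment> \<open>For nonempty \<open>t\<close> the splittings \<open>([], t)\<close> and
    \<open>(t, [])\<close> differ and can be taken out one after the other.\<close>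
  have g: "(\<Sum>p\<in>splits2 t. ?g b c p) = ?g b c ([], t) + ?g b c (t, [])
     + (\<Sum>p\<in>splits2 t - {([], t), (t, [])}. ?g b c p)" for b c
    using t(2) finite_splits2 [of t]
      sum.remove [of "splits2 t" "([], t)" "?g b c"]
      sum.remove [of "splits2 t - {([], t)}" "(t, [])" "?g b c"]
    by (simp add: splits2_def insert_commute add.assoc flip: Diff_insert)
  have rel: "?A + ((\<Sum>(b, c)\<in>splits2 as. ?g b c ([], t)) + (\<Sum>(b, c)\<in>splits2 as. ?g b c (t, [])) + ?R)
      + ?C = 0"
    using ainf_relation_tail [OF as t(1) y] unfolding g by (simp add: sum.distrib case_prod_beta)
  \<comment> \<open>Here the transformation acts first: the inner operation contains
    \<open>y\<close> and the whole of \<open>t\<close>. The exponents agree modulo 2 because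
    \<open>sdeg as = sdeg b + sdeg c\<close>.\<close>
  have 1: "(\<Sum>(b, c)\<in>splits2 as. ksign (?n * sdeg b)
         (mu C (b @ [Arrow (string_end X b) L (i + (sdeg c + ?n)) (?T (string_end X b) c i y)])))
     = ksign ?e (\<Sum>(b, c)\<in>splits2 as. ?g b c (t, []))"
    unfolding ksign_sum
  proof (intro sum.cong refl)
    fix p assume p: "p \<in> splits2 as"
    obtain b c where bc: "p = (b, c)" by (cases p)
    note bc' = splits2_strings [OF as p [unfolded bc]]
    have "mu C (b @ [Arrow (string_end X b) L (i + (sdeg c + ?n)) (?T (string_end X b) c i y)])
      = ksign (sdeg t * (sdeg c + i - 1)) (mu C (b @ [mu_arrow C (c @ ?y # t)]))"
      using mu_ksign [OF is_string_insert [OF bc'(1) nil(1) mu_insert_Hom [OF bc'(2) t(1) y]]]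
      by (simp add: tail_trans_eq [OF bc'(2) y] mu_arrow_insert [OF bc'(2) t(1) y])
    then show "(case p of (b, c) \<Rightarrow> ksign (?n * sdeg b)
         (mu C (b @ [Arrow (string_end X b) L (i + (sdeg c + ?n)) (?T (string_end X b) c i y)])))
       = ksign ?e (case p of (b, c) \<Rightarrow> ?g b c (t, []))"
      by (auto simp: bc bc'(3) intro!: ksign_parity)
  qed
  \<comment> \<open>Here the functor acts first, so the argument of \<open>tail_trans\<close> is
    m(d,y), of degree \<open>i + (sdeg d + 1)\<close>; its sign exponent is computed with this
    degree in place of \<open>i\<close>.\<close>
  have 2: "(\<Sum>(c, d)\<in>splits2 as. ksign (sdeg c + ?n + 1)
         (?T X c (i + (sdeg d + 1)) (mu C (d @ [?y]))))
     = ksign ?e (\<Sum>(b, c)\<in>splits2 as. ?g b c ([], t))"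
    unfolding ksign_sum
  proof (intro sum.cong refl)
    fix p assume p: "p \<in> splits2 as"
    obtain c d where cd: "p = (c, d)" by (cases p)
    note cd' = splits2_strings [OF as p [unfolded cd]]
    have "?T X c (i + (sdeg d + 1)) (mu C (d @ [?y]))
      = ksign (sdeg t * (sdeg c + i + sdeg d)) (mu C (c @ mu_arrow C (d @ [?y]) # t))"
      using tail_trans_eq [OF cd'(1) mu_insert_Hom [OF cd'(2) nil(2) y], of t]
        mu_arrow_insert [OF cd'(2) nil(2) y]
      by (simp add: add.assoc)
    then show "(case p of (c, d) \<Rightarrow> ksign (sdeg c + ?n + 1)
         (?T X c (i + (sdeg d + 1)) (mu C (d @ [?y]))))
       = ksign ?e (case p of (b, c) \<Rightarrow> ?g b c ([], t))"
      by (auto simp: cd cd'(3) intro!: ksign_parity)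
  qed
  \<comment> \<open>An inner operation raises the shifted degree by one, which changes the exponent
    by \<open>sdeg t\<close>; the factor with exponent \<open>?n - 1\<close>, again
    \<open>sdeg t\<close>, compensates it.\<close>
  have 3: "ksign (?n - 1) (\<Sum>(b, c, d)\<in>inner_splits as. ksign (sdeg b) (?T X (b @ mu_arrow C c # d) i y))
     = ksign ?e ?A"
    unfolding ksign_sum
  proof (intro sum.cong refl)
    fix p assume p: "p \<in> inner_splits as"
    obtain b c d where bcd: "p = (b, c, d)" by (cases p)
    have bcd': "as = b @ c @ d" "c \<noteq> []"
      using p by (auto simp: bcd inner_splits_def)
    note s = is_string_mu_arrow [OF as [unfolded bcd'(1)] bcd'(2)]
    show "ksign (?n - 1) (case p of (b, c, d) \<Rightarrow> ksign (sdeg b) (?T X (b @ mu_arrow C c # d) i y))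
       = ksign ?e (case p of (b, c, d) \<Rightarrow> ksign (sdeg b) (mu C (b @ mu_arrow C c # d @ ?y # t)))"
      using tail_trans_eq [OF s(1) y, of t] s(2)
      by (auto simp: bcd bcd'(1) simp del: sdeg_append intro!: ksign_parity)
  qed
  have "trans_M1 C (CH (scl C)) ?n (yoneda C L) (yoneda C L') ?T X as i y =
    - ksign ?e (\<Sum>(b, c)\<in>splits2 as. ?g b c (t, [])) - ksign ?e (\<Sum>(b, c)\<in>splits2 as. ?g b c ([], t))
    - ksign ?e ?A"
    unfolding trans_M1_yoneda [OF pre_natural_tail_trans [OF t(1)] as y L] 1 2 3 ..
  also have "\<dots> = ksign ?e (?R + ?C)"
  proof -
    have "?R + ?C = - (\<Sum>(b, c)\<in>splits2 as. ?g b c (t, [])) - (\<Sum>(b, c)\<in>splits2 as. ?g b c ([], t)) - ?A"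
      using rel by (simp add: algebra_simps eq_neg_iff_add_eq_0)
    then show ?thesis
      by (simp add: ksign_diff ksign_minus)
  qed
  finally show ?thesis .
qed

section \<open>Differences of transformations\<close>

lemma pre_natural_yoneda_diff:
  assumes T: "pre_natural C (CH (scl C)) n (yoneda C L) (yoneda C L') T"
    and T': "pre_natural C (CH (scl C)) n (yoneda C L) (yoneda C L') T'"
    and L: "L \<in> Obj C"
  shows "pre_natural C (CH (scl C)) n (yoneda C L) (yoneda C L') (\<lambda>X as. T X as - T' X as)"
  unfolding pre_natural_def
proof (intro conjI allI impI ballI)
  fix X as Y assume as: "is_string C X as Y"
  have "linear_between (scl C) (Hom C Y L' i) (Hom C X L (i + (sdeg as + n)))
     (\<lambda>y. T X as i y - T' X as i y)" for i
    using pre_natural_yoneda_linear [OF T as, of i] pre_natural_yoneda_linear [OF T' as, of i]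
      is_string_Obj [OF as] L
    by (simp add: linear_between_def Hom_diff scale_right_diff_distrib)
  moreover have "(T X as - T' X as) i = (\<lambda>y. T X as i y - T' X as i y)" for i
    by (simp add: fun_eq_iff)
  ultimately show "T X as - T' X as
      \<in> Hom (CH (scl C)) (fobj (yoneda C L) X) (fobj (yoneda C L') Y) (sdeg as + n)"
    by (simp add: dg_hom_def)
next
  fix X assume X: "X \<in> Obj C"
  have "multilinear_from C (scl (CH (scl C))) X (T X)" "multilinear_from C (scl (CH (scl C))) X (T' X)"
    using T T' X by (auto simp: pre_natural_def)
  then show "multilinear_from C (scl (CH (scl C))) X (\<lambda>as. T X as - T' X as)"
    by (simp add: multilinear_from_def fun_eq_iff scale_right_diff_distrib)
qed

text \<open>Prepares a homotopy that is a difference of two tail transformations. In the first sum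
  of \<open>trans_M1_yoneda\<close> the map \<open>T\<close> stands inside \<open>mu\<close>, so
  multilinearity enters there; the other sums are visibly linear in \<open>T\<close>.\<close>

lemma trans_M1_yoneda_diff:
  assumes T: "pre_natural C (CH (scl C)) n (yoneda C L) (yoneda C L') T"
    and T': "pre_natural C (CH (scl C)) n (yoneda C L) (yoneda C L') T'"
    and L: "L \<in> Obj C" "L' \<in> Obj C" and as: "is_string C X as Y"
  shows "trans_M1 C (CH (scl C)) n (yoneda C L) (yoneda C L') (\<lambda>X as. T X as - T' X as) X as i y =
      trans_M1 C (CH (scl C)) n (yoneda C L) (yoneda C L') T X as i y
    - trans_M1 C (CH (scl C)) n (yoneda C L) (yoneda C L') T' X as i y"
proof (cases "y \<in> Hom C Y L' i")
  case True
  have nil: "is_string C L [] L"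
    using L by simp
  have "(\<Sum>(b, c)\<in>splits2 as. ksign (n * sdeg b)
         (mu C (b @ [Arrow (string_end X b) L (i + (sdeg c + n))
            ((T (string_end X b) c - T' (string_end X b) c) i y)])))
    = (\<Sum>(b, c)\<in>splits2 as. ksign (n * sdeg b)
         (mu C (b @ [Arrow (string_end X b) L (i + (sdeg c + n)) (T (string_end X b) c i y)])))
    - (\<Sum>(b, c)\<in>splits2 as. ksign (n * sdeg b)
         (mu C (b @ [Arrow (string_end X b) L (i + (sdeg c + n)) (T' (string_end X b) c i y)])))"
    unfolding sum_subtractf [symmetric]
  proof (intro sum.cong refl)
    fix p assume p: "p \<in> splits2 as"
    obtain b c where bc: "p = (b, c)" by (cases p)
    note bc' = splits2_strings [OF as p [unfolded bc]]
    have "T (string_end X b) c i y \<in> Hom C (string_end X b) L (i + (sdeg c + n))"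
      "T' (string_end X b) c i y \<in> Hom C (string_end X b) L (i + (sdeg c + n))"
      using pre_natural_yoneda_linear [OF T bc'(2)] pre_natural_yoneda_linear [OF T' bc'(2)] True
      by (auto simp: linear_between_def)
    then show "(case p of (b, c) \<Rightarrow> ksign (n * sdeg b)
         (mu C (b @ [Arrow (string_end X b) L (i + (sdeg c + n))
            ((T (string_end X b) c - T' (string_end X b) c) i y)])))
      = (case p of (b, c) \<Rightarrow> ksign (n * sdeg b)
         (mu C (b @ [Arrow (string_end X b) L (i + (sdeg c + n)) (T (string_end X b) c i y)])))
      - (case p of (b, c) \<Rightarrow> ksign (n * sdeg b)
         (mu C (b @ [Arrow (string_end X b) L (i + (sdeg c + n)) (T' (string_end X b) c i y)])))"
      using is_string_insert [OF bc'(1) nil]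
      by (simp add: bc ksign_diff mu_diff [where X = X and Y = L])
  qed
  then show ?thesis
    unfolding trans_M1_yoneda [OF T as True L] trans_M1_yoneda [OF T' as True L]
      trans_M1_yoneda [OF pre_natural_yoneda_diff [OF T T' L(1)] as True L]
    by (simp add: case_prod_beta sum_subtractf ksign_diff)
next
  case False
  then show ?thesis
    using trans_M1_yoneda_outside [OF _ as False L] T T' pre_natural_yoneda_diff [OF T T' L(1)]
    by simp
qed

section \<open>Composition and homotopy\<close>

text \<open>A tail of one letter has no proper splitting, so what \<open>trans_M1_tail\<close>
  leaves is the term with m_1(x) as its last input, and m_1(x) is 0.\<close>

lemma natural_trans_tail:
  assumes x: "x \<in> Hom C L' L n" "mu C [Arrow L' L n x] = 0" and L: "L \<in> Obj C" "L' \<in> Obj C"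
  shows "natural_trans C (CH (scl C)) n (yoneda C L) (yoneda C L') (tail_trans C L' [Arrow L' L n x])"
  unfolding natural_trans_def
proof (intro conjI allI impI ext)
  let ?x = "Arrow L' L n x"
  have t: "is_string C L' [?x] L"
    using x L by simp
  show pre: "pre_natural C (CH (scl C)) n (yoneda C L) (yoneda C L') (tail_trans C L' [?x])"
    using pre_natural_tail_trans [OF t] by simp
  fix X as Y i y assume as: "is_string C X as Y"
  show "trans_M1 C (CH (scl C)) n (yoneda C L) (yoneda C L') (tail_trans C L' [?x]) X as i y
      = 0 i y"
  proof (cases "y \<in> Hom C Y L' i")
    case True
    \<comment> \<open>With m_1(x) = 0 the last letter becomes a zero in degree \<open>n + 1\<close>;
      this string makes it a legitimate input for \<open>mu_zero\<close>.\<close>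
    have "is_string C X (as @ Arrow Y L' i y # [Arrow L' L (n + 1) 0]) L"
      using is_string_insert [OF as _ True, of "[Arrow L' L (n + 1) 0]" L] L by (simp add: Hom_zero)
    then have "mu C (as @ [Arrow Y L' i y, mu_arrow C [?x]]) = 0"
      using mu_zero [of X "as @ [Arrow Y L' i y]" L' L "n + 1" 0 "[]" L] x(2)
      by (simp add: mu_arrow_def add.commute)
    then show ?thesis
      using trans_M1_tail [OF t _ as True] by simp
  next
    case False
    then show ?thesis
      using trans_M1_yoneda_outside [OF pre as False L] by simp
  qed
qed

text \<open>Both tails have shifted degree -1, and their two exponents add up to
  \<open>sdeg b\<close> modulo 2. The result has the form of the middle terms of
  \<open>trans_M1_tail\<close> for the two-letter tail made of \<open>x'\<close> and
  \<open>x\<close>.\<close>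

lemma trans_M2_tail:
  assumes x: "x \<in> Hom C L' L 0" and x': "x' \<in> Hom C L L' 0" and L: "L \<in> Obj C" "L' \<in> Obj C"
    and as: "is_string C X as Y" and y: "y \<in> Hom C Y L i"
  shows "trans_M2 (CH (scl C)) 0 0 (yoneda C L) (yoneda C L') (yoneda C L)
      (tail_trans C L' [Arrow L' L 0 x]) (tail_trans C L [Arrow L L' 0 x']) X as i y
    = (\<Sum>(b, c)\<in>splits2 as. ksign (sdeg b)
        (mu C (b @ [mu_arrow C (c @ [Arrow Y L i y, Arrow L L' 0 x']), Arrow L' L 0 x])))"
  unfolding trans_M2_CH sum_apply
proof (intro sum.cong refl)
  fix p assume p: "p \<in> splits2 as"
  obtain b c where bc: "p = (b, c)" by (cases p)
  note bc' = splits2_strings [OF as p [unfolded bc]]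
  have t: "is_string C L' [Arrow L' L 0 x] L" and t': "is_string C L [Arrow L L' 0 x'] L'"
    using x x' L by simp_all
  let ?w = "mu C (c @ [Arrow Y L i y, Arrow L L' 0 x'])"
  have w: "?w \<in> Hom C (string_end X b) L' (i + sdeg c)"
    using mu_insert_Hom [OF bc'(2) t' y] by simp
  have obj: "string_end X b \<in> Obj C"
    using is_string_Obj [OF bc'(2)] by simp
  have "tail_trans C L' [Arrow L' L 0 x] X b (i + sdeg c)
      (tail_trans C L [Arrow L L' 0 x'] (string_end X b) c i y)
    = ksign (sdeg b) (mu C (b @ [Arrow (string_end X b) L' (i + sdeg c) ?w, Arrow L' L 0 x]))"
    using mu_ksign [OF is_string_insert [OF bc'(1) t w]]
    by (auto simp: tail_trans_eq [OF bc'(2) y] tail_trans_eq [OF bc'(1) ksign_Hom] obj L w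
        intro!: ksign_parity)
  then show "(case p of (c, e) \<Rightarrow> dg_comp (tail_trans C L' [Arrow L' L 0 x] X c) (sdeg e)
      (tail_trans C L [Arrow L L' 0 x'] (string_end X c) e)) i y
    = (case p of (b, c) \<Rightarrow> ksign (sdeg b)
        (mu C (b @ [mu_arrow C (c @ [Arrow Y L i y, Arrow L L' 0 x']), Arrow L' L 0 x])))"
    using mu_arrow_insert [OF bc'(2) t' y] by (simp add: bc dg_comp_def)
qed

lemma trans_M2_tail_outside:
  assumes x: "x \<in> Hom C L' L 0" and x': "x' \<in> Hom C L L' 0" and L: "L \<in> Obj C" "L' \<in> Obj C"
    and as: "is_string C X as Y" and y: "y \<notin> Hom C Y L i"
  shows "trans_M2 (CH (scl C)) 0 0 (yoneda C L) (yoneda C L') (yoneda C L)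
      (tail_trans C L' [Arrow L' L 0 x]) (tail_trans C L [Arrow L L' 0 x']) X as i y = 0"
  unfolding trans_M2_CH sum_apply
proof (intro sum.neutral ballI)
  fix p assume p: "p \<in> splits2 as"
  obtain b c where bc: "p = (b, c)" by (cases p)
  note bc' = splits2_strings [OF as p [unfolded bc]]
  have t: "is_string C L' [Arrow L' L 0 x] L"
    using x L by simp
  have "tail_trans C L [Arrow L L' 0 x'] (string_end X b) c i y = 0"
    using y is_string_end [OF bc'(2)] by (simp add: tail_trans_def)
  moreover have "tail_trans C L' [Arrow L' L 0 x] X b j 0 = 0" for j
    using tail_trans_dg_hom [OF bc'(1) t] linear_between_zero by (auto simp: dg_hom_def)
  ultimately show "(case p of (c, e) \<Rightarrow> dg_comp (tail_trans C L' [Arrow L' L 0 x] X c) (sdeg e)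
      (tail_trans C L [Arrow L L' 0 x'] (string_end X c) e)) i y = 0"
    by (simp add: bc dg_comp_def)
qed

text \<open>The roles of \<open>L\<close> and \<open>L'\<close> can be exchanged, so this one
  statement serves both composites.\<close>

lemma tail_trans_composition:
  assumes unital: "strictly_unital C" and L: "L \<in> Obj C" "L' \<in> Obj C"
    and x: "x \<in> Hom C L' L 0" and x': "x' \<in> Hom C L L' 0" and \<gamma>: "\<gamma> \<in> Hom C L L (- 1)"
    and closed: "mu C [Arrow L' L 0 x] = 0" "mu C [Arrow L L' 0 x'] = 0"
    and inv: "mu C [Arrow L L' 0 x', Arrow L' L 0 x] = unt C L + mu C [Arrow L L (- 1) \<gamma>]"
  shows "cohomologous_trans C (CH (scl C)) 0 (yoneda C L) (yoneda C L)
    (trans_M2 (CH (scl C)) 0 0 (yoneda C L) (yoneda C L') (yoneda C L)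
      (tail_trans C L' [Arrow L' L 0 x]) (tail_trans C L [Arrow L L' 0 x']))
    (trans_id (CH (scl C)) (yoneda C L))"
proof -
  let ?x = "Arrow L' L 0 x" and ?x' = "Arrow L L' 0 x'" and ?\<gamma> = "Arrow L L (- 1) \<gamma>"
  let ?P = "tail_trans C L [?x', ?x]" and ?G = "tail_trans C L [?\<gamma>]"
  let ?M1 = "trans_M1 C (CH (scl C)) (- 1) (yoneda C L) (yoneda C L)"
  let ?M2 = "trans_M2 (CH (scl C)) 0 0 (yoneda C L) (yoneda C L') (yoneda C L)
      (tail_trans C L' [?x]) (tail_trans C L [?x'])"
  \<comment> \<open>The first part of the homotopy produces the composite and a term with m_2(x',x);
    the second removes the m_1(\<gamma>) part of that value and leaves the unit. Both tails have
    shifted degree -2, so both parts have degree -1.\<close>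
  let ?H = "\<lambda>X as. ?P X as - ?G X as"
  have tP: "is_string C L [?x', ?x] L" and tG: "is_string C L [?\<gamma>] L"
    using x x' \<gamma> L by simp_all
  have P: "pre_natural C (CH (scl C)) (- 1) (yoneda C L) (yoneda C L) ?P"
    and G: "pre_natural C (CH (scl C)) (- 1) (yoneda C L) (yoneda C L) ?G"
    using pre_natural_tail_trans [OF tP] pre_natural_tail_trans [OF tG] by simp_all
  note H = pre_natural_yoneda_diff [OF P G L(1)]
  have main: "?M2 X as i y = trans_id (CH (scl C)) (yoneda C L) X as i y + ?M1 ?H X as i y"
    if as: "is_string C X as Y" for X as Y i y
  proof (cases "y \<in> Hom C Y L i")
    case y: True
    let ?y = "Arrow Y L i y"
    have obj: "X \<in> Obj C" "Y \<in> Obj C"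
      using is_string_Obj [OF as] by simp_all
    have m\<gamma>: "mu C [?\<gamma>] \<in> Hom C L L 0"
      using mu_Hom [OF tG] by simp
    have u: "unt C L \<in> Hom C L L 0"
      using unital L by (simp add: strictly_unital_def)
    have s: "is_string C X (as @ [?y, Arrow L L 0 z]) L" if "z \<in> Hom C L L 0" for z
      using is_string_insert [OF as _ y, of "[Arrow L L 0 z]" L] that L by simp
    \<comment> \<open>Closedness of \<open>x'\<close>, and in the next step of \<open>x\<close>,
      removes the terms with m_1 inside the tail.\<close>
    have z1: "mu C (as @ [?y, mu_arrow C [?x'], ?x]) = 0"
    proof -
      have "is_string C X (as @ [?y, Arrow L L' 1 0, ?x]) L"
        using is_string_insert [OF as _ y, of "[Arrow L L' 1 0, ?x]" L] x L by (simp add: Hom_zero)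
      then show ?thesis
        using mu_zero [of X "as @ [?y]" L L' 1 0 "[?x]" L] closed by (simp add: mu_arrow_def)
    qed
    have z2: "mu C (as @ [?y, ?x', mu_arrow C [?x]]) = 0"
    proof -
      have "is_string C X (as @ [?y, ?x', Arrow L' L 1 0]) L"
        using is_string_insert [OF as _ y, of "[?x', Arrow L' L 1 0]" L] x' L by (simp add: Hom_zero)
      then show ?thesis
        using mu_zero [of X "as @ [?y, ?x']" L' L 1 0 "[]" L] closed by (simp add: mu_arrow_def)
    qed
    have "?M1 ?P X as i y = ?M2 X as i y + ksign (sdeg as + (i - 1)) (mu C (as @ [?y, mu_arrow C [?x', ?x]]))"
    proof -
      \<comment> \<open>The single proper splitting of the tail gives the composite, and of the
        inner operations on the tail m_2 survives. The common sign is trivial because the shifted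
        degree of the tail is even.\<close>
      have "splits2 [?x', ?x] - {([], [?x', ?x]), ([?x', ?x], [])} = {([?x'], [?x])}"
        "inner_splits [?x', ?x] = {([], [?x'], [?x]), ([], [?x', ?x], []), ([?x'], [?x], [])}"
        by auto
      then show ?thesis
        using trans_M1_tail [OF tP _ as y] trans_M2_tail [OF x x' L as y]
        by (simp add: z1 z2 ksign_even)
    qed
    moreover have "?M1 ?G X as i y = ksign (sdeg as + (i - 1)) (mu C (as @ [?y, Arrow L L 0 (mu C [?\<gamma>])]))"
    proof -
      have "splits2 [?\<gamma>] - {([], [?\<gamma>]), ([?\<gamma>], [])} = {}" "inner_splits [?\<gamma>] = {([], [?\<gamma>], [])}"
        by auto
      then show ?thesis
        using trans_M1_tail [OF tG _ as y]
        by (auto simp: mu_arrow_def intro!: ksign_parity)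
    qed
    moreover have "mu C (as @ [?y, mu_arrow C [?x', ?x]])
        = mu C (as @ [?y, unit_arrow C L]) + mu C (as @ [?y, Arrow L L 0 (mu C [?\<gamma>])])"
      using mu_add [of X "as @ [?y]" L L 0 "unt C L" "[]" L "mu C [?\<gamma>]"] s [OF u] s [OF m\<gamma>]
      by (simp add: mu_arrow_def inv unit_arrow_def)
    \<comment> \<open>For empty \<open>as\<close>, m_2(y,1) equals \<open>y\<close> up to the sign
      with exponent \<open>i\<close>, while the exponent here is \<open>i - 1\<close>, whence the
      minus. For nonempty \<open>as\<close> the unit is an input of a higher operation, so both
      sides are 0.\<close>
    moreover have "trans_id (CH (scl C)) (yoneda C L) X as i y
        = - ksign (sdeg as + (i - 1)) (mu C (as @ [?y, unit_arrow C L]))"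
    proof (cases "as = []")
      case True
      have "is_string C X [?y] L"
        using obj True as y L by simp
      then have "ksign i (mu C [?y, unit_arrow C L]) = y"
        using unital unfolding strictly_unital_def by (metis arrow.sel(3) arrow.sel(4))
      then have "- ksign (i - 1) (mu C [?y, unit_arrow C L]) = y"
        unfolding ksign_plus_one [symmetric] by simp
      moreover have "trans_id (CH (scl C)) (yoneda C L) X as i y = y"
        using True as y by (simp add: trans_id_def dg_id_def)
      ultimately show ?thesis
        using True by (simp only: append_Nil sdeg_Nil add_0)
    next
      case False
      have "is_string C X ((as @ [?y]) @ unit_arrow C L # []) L"
        using s [OF u] by (simp add: unit_arrow_def)
      moreover have "length ((as @ [?y]) @ unit_arrow C L # []) \<noteq> 2"
        using False by simp
      ultimately have "mu C ((as @ [?y]) @ unit_arrow C L # []) = 0"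
        using unital unfolding strictly_unital_def by blast
      then show ?thesis
        using False by (simp add: trans_id_def)
    qed
    ultimately show ?thesis
      unfolding trans_M1_yoneda_diff [OF P G L(1) L(1) as]
      by (simp add: ksign_add)
  next
    case False
    \<comment> \<open>Off the domain the identity has the default value 0 as well, by
      \<open>dg_id_def\<close>.\<close>
    then show ?thesis
      using trans_M1_yoneda_outside [OF H as False L(1) L(1)] trans_M2_tail_outside [OF x x' L as False]
        is_string_end [OF as]
      by (auto simp: trans_id_def dg_id_def)
  qed
  show ?thesis
    unfolding cohomologous_trans_def
  proof (intro exI conjI allI impI ext)
    show "pre_natural C (CH (scl C)) (0 - 1) (yoneda C L) (yoneda C L) ?H"
      using H by simp
    show "?M2 X as i y = (trans_id (CH (scl C)) (yoneda C L) X as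
        + trans_M1 C (CH (scl C)) (0 - 1) (yoneda C L) (yoneda C L) ?H X as) i y"
      if "is_string C X as Y" for X as Y i y
      using main [OF that] by simp
  qed
qed

section \<open>Quasi-isomorphism of the Yoneda functors\<close>

lemma quasi_isomorphic_yoneda:
  assumes "strictly_unital C" and "L0 \<in> Obj C" and "L1 \<in> Obj C"
    and "\<alpha> \<in> Hom C L0 L1 0" and "\<beta> \<in> Hom C L1 L0 0"
    and "\<gamma>1 \<in> Hom C L0 L0 (- 1)" and "\<gamma>2 \<in> Hom C L1 L1 (- 1)"
    and "mu C [Arrow L0 L1 0 \<alpha>] = 0" and "mu C [Arrow L1 L0 0 \<beta>] = 0"
    and "mu C [Arrow L0 L1 0 \<alpha>, Arrow L1 L0 0 \<beta>] = unt C L0 + mu C [Arrow L0 L0 (- 1) \<gamma>1]"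
    and "mu C [Arrow L1 L0 0 \<beta>, Arrow L0 L1 0 \<alpha>] = unt C L1 + mu C [Arrow L1 L1 (- 1) \<gamma>2]"
  shows "quasi_isomorphic_functors C (CH (scl C)) (yoneda C L0) (yoneda C L1)"
  unfolding quasi_isomorphic_functors_def
  \<comment> \<open>The witnesses are \<open>tail_trans C L1 [Arrow L1 L0 0 \<beta>]\<close> and
    \<open>tail_trans C L0 [Arrow L0 L1 0 \<alpha>]\<close>. The composition lemma is applied with
    \<gamma>1 for one order and, with the two objects exchanged, with \<gamma>2 for the
    other.\<close>
  using assms ainf_functor_yoneda natural_trans_tail tail_trans_composition by blast

end

theorem theorem4p2:
  fixes C :: "('k::comm_ring_1, 'o, 'a::ab_group_add) ainf_cat"
    and L0 L1 :: 'o and \<alpha> \<beta> \<gamma>1 \<gamma>2 :: 'a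
  assumes "ainf_category C" and "strictly_unital C"
    and "L0 \<in> Obj C" and "L1 \<in> Obj C"
    and "\<alpha> \<in> Hom C L0 L1 0" and "\<beta> \<in> Hom C L1 L0 0"
    and "\<gamma>1 \<in> Hom C L0 L0 (- 1)" and "\<gamma>2 \<in> Hom C L1 L1 (- 1)"
    and "mu C [Arrow L0 L1 0 \<alpha>] = 0" and "mu C [Arrow L1 L0 0 \<beta>] = 0"
    and "mu C [Arrow L0 L1 0 \<alpha>, Arrow L1 L0 0 \<beta>] = unt C L0 + mu C [Arrow L0 L0 (- 1) \<gamma>1]"
    and "mu C [Arrow L1 L0 0 \<beta>, Arrow L0 L1 0 \<alpha>] = unt C L1 + mu C [Arrow L1 L1 (- 1) \<gamma>2]"
  shows "quasi_isomorphic_functors C (CH (scl C)) (yoneda C L0) (yoneda C L1) \<and>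
         quasi_isomorphic_objects C L0 L1"
proof
  interpret ainf_cat C
    using assms(1) by unfold_locales
  show "quasi_isomorphic_functors C (CH (scl C)) (yoneda C L0) (yoneda C L1)"
    using quasi_isomorphic_yoneda assms(2-) by blast
  show "quasi_isomorphic_objects C L0 L1"
    \<comment> \<open>The given \<alpha>, \<beta>, \<gamma>1 and \<gamma>2 are the witnesses;
      \<open>diff_0\<close> turns the degree \<open>0 - 1\<close> from \<open>cohomologous\<close>
      into \<open>- 1\<close>.\<close>
    using assms(3-) unfolding quasi_isomorphic_objects_def cohomologous_def diff_0 by blast
qed

end
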